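(* Let $(\mathcal{A}^{(n)},\tau^{(n)})$, $n\in\mathbb{N}$, and $(\mathcal{A},\tau)$ be $C^*$-probability spaces with faithful traces. For each $n$ let $x^{(n)}=(x_1^{(n)},\dots,x_m^{(n)})$ be a tuple of elements of $\mathcal{A}^{(n)}$, let $x=(x_1,\dots,x_m)$ be a tuple of elements of $\mathcal{A}$, and assume that $x^{(n)}$ strongly converges to $x$. Let $r$ be any non-commutative rational expression in $2m$ indeterminates such that $(x,x^* )$ lies in the domain of $r$. Then $r(x^{(n)},(x^{(n)})^* )$ is defined for all sufficiently large $n$, and $$\lim_{n\to\infty}\tau^{(n)}\big(r(x^{(n)},(x^{(n)})^* )\big)=\tau\big(r(x,x^* )\big),\qquad \lim_{n\to\infty}\big\|r(x^{(n)},(x^{(n)})^* )\big\|_{\mathcal{A}^{(n)}}=\big\|r(x,x^* )\big\|_{\mathcal{A}}.$$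
   Context: A $C^*$-probability space $(\mathcal{A},\tau)$ is a unital $C^*$-algebra $\mathcal{A}$ with a state $\tau$; "with faithful trace" means that $\tau$ is a faithful tracial state. For a tuple $x=(x_1,\dots,x_m)$, write $x^*=(x_1^*,\dots,x_m^* )$, and $(x,x^* )$ for the resulting $2m$-tuple. Strong convergence: $x^{(n)}$ strongly converges to $x$ if for every polynomial $p$ (complex coefficients) in $2m$ non-commuting indeterminates, $\lim_n\tau^{(n)}(p(x^{(n)},(x^{(n)})^* ))=\tau(p(x,x^* ))$ and $\lim_n\|p(x^{(n)},(x^{(n)})^* )\|_{\mathcal{A}^{(n)}}=\|p(x,x^* )\|_{\mathcal{A}}$. Rational expressions: let $\mathscr{P}$ be the algebra of complex polynomials in $2m$ non-commuting indeterminates. Put $\mathfrak{R}_0=\mathscr{P}$, and for $k\ge1$ let $\mathfrak{R}_k$ be the free complex unital algebra on the alphabet $\mathfrak{R}_{k-1}\cup\mathfrak{R}_{k-1}^{-1}$, where $\mathfrak{R}_{k-1}^{-1}=\{\beta^{-1}:\beta\in\mathfrak{R}_{k-1}\}$ is a set of formal symbols (also $0^{-1}$ is a valid letter). Sending an element of $\mathfrak{R}_{k-1}$ to the corresponding letter gives an inclusion $\mathfrak{R}_{k-1}\to\mathfrak{R}_k$; the direct limit is $\mathfrak{R}_\infty$, and its elements are the rational expressions. Thus a rational expression is a formal finite combination of sums, products and formal inverses starting from polynomials. Evaluation and domain: for a $2m$-tuple $a$ in a unital algebra $\mathcal{B}$, polynomials are evaluated as usual; a letter $\beta\in\mathfrak{R}_{k-1}$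 is evaluated as $\beta(a)$; a letter $\beta^{-1}$ is evaluated as $\beta(a)^{-1}$, which is defined iff $\beta(a)$ is defined and invertible in $\mathcal{B}$; linear combinations of words are evaluated accordingly when all letters occurring in them can be evaluated. The domain of a rational expression (over $\mathcal{B}$) is the set of tuples $a$ at which its evaluation is defined. *)

theory Defs
  imports
    Complex_Main
    "HOL-Algebra.Module"
    "HOL-Library.FSet"
    "HOL-Library.Nonpos_Ints"
    "HOL-Library.Poly_Mapping"
begin

section \<open>Unital C*-algebras and C*-probability spaces\<close>

text \<open>
  Algebras are carrier-based, extending the ring records of HOL-Algebra, because the algebras of a
  sequence may all be different.  Nothing is assumed about values off the carrier.
\<close>

record 'a cstar_struct = "(complex, 'a) module" +
  adj :: "'a \<Rightarrow> 'a"
  nrm :: "'a \<Rightarrow> real"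

locale unital_cstar_algebra = ring A for A (structure) +
  assumes smult_closed: "a \<in> carrier A \<Longrightarrow> c \<odot> a \<in> carrier A"
    and smult_l_distr: "a \<in> carrier A \<Longrightarrow> (c + d) \<odot> a = (c \<odot> a) \<oplus> (d \<odot> a)"
    and smult_r_distr: "a \<in> carrier A \<Longrightarrow> b \<in> carrier A \<Longrightarrow> c \<odot> (a \<oplus> b) = (c \<odot> a) \<oplus> (c \<odot> b)"
    and smult_assoc: "a \<in> carrier A \<Longrightarrow> (c * d) \<odot> a = c \<odot> (d \<odot> a)"
    and smult_one: "a \<in> carrier A \<Longrightarrow> 1 \<odot> a = a"
    and smult_mult_left: "a \<in> carrier A \<Longrightarrow> b \<in> carrier A \<Longrightarrow> (c \<odot> a) \<otimes> b = c \<odot> (a \<otimes> b)"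
    and smult_mult_right: "a \<in> carrier A \<Longrightarrow> b \<in> carrier A \<Longrightarrow> a \<otimes> (c \<odot> b) = c \<odot> (a \<otimes> b)"
    and adj_closed: "a \<in> carrier A \<Longrightarrow> adj A a \<in> carrier A"
    and adj_adj: "a \<in> carrier A \<Longrightarrow> adj A (adj A a) = a"
    and adj_add: "a \<in> carrier A \<Longrightarrow> b \<in> carrier A \<Longrightarrow> adj A (a \<oplus> b) = adj A a \<oplus> adj A b"
    and adj_smult: "a \<in> carrier A \<Longrightarrow> adj A (c \<odot> a) = cnj c \<odot> adj A a"
    and adj_mult: "a \<in> carrier A \<Longrightarrow> b \<in> carrier A \<Longrightarrow> adj A (a \<otimes> b) = adj A b \<otimes> adj A a"
    and nrm_nonneg: "a \<in> carrier A \<Longrightarrow> 0 \<le> nrm A a"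
    and nrm_eq_0: "a \<in> carrier A \<Longrightarrow> nrm A a = 0 \<Longrightarrow> a = \<zero>"
    and nrm_triangle: "a \<in> carrier A \<Longrightarrow> b \<in> carrier A \<Longrightarrow> nrm A (a \<oplus> b) \<le> nrm A a + nrm A b"
    and nrm_smult: "a \<in> carrier A \<Longrightarrow> nrm A (c \<odot> a) = cmod c * nrm A a"
    and nrm_mult: "a \<in> carrier A \<Longrightarrow> b \<in> carrier A \<Longrightarrow> nrm A (a \<otimes> b) \<le> nrm A a * nrm A b"
    and cstar_identity: "a \<in> carrier A \<Longrightarrow> nrm A (adj A a \<otimes> a) = (nrm A a)\<^sup>2"
    and complete: "\<And>s :: nat \<Rightarrow> 'a. range s \<subseteq> carrier A \<Longrightarrow>
        (\<forall>e>0. \<exists>N. \<forall>i\<ge>N. \<forall>j\<ge>N. nrm A (s i \<ominus> s j) < e) \<Longrightarrow>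
        \<exists>l\<in>carrier A. (\<lambda>i. nrm A (s i \<ominus> l)) \<longlonglongrightarrow> 0"

locale cstar_probability_space = unital_cstar_algebra A for A (structure) +
  fixes \<tau> :: "'a \<Rightarrow> complex"
  assumes state_add: "a \<in> carrier A \<Longrightarrow> b \<in> carrier A \<Longrightarrow> \<tau> (a \<oplus> b) = \<tau> a + \<tau> b"
    and state_smult: "a \<in> carrier A \<Longrightarrow> \<tau> (c \<odot> a) = c * \<tau> a"
    and state_positive: "a \<in> carrier A \<Longrightarrow> \<tau> (adj A a \<otimes> a) \<in> \<real>\<^sub>\<ge>\<^sub>0"
    and state_unital: "\<tau> \<one> = 1"

locale cstar_probability_space_faithful_trace = cstar_probability_space +
  assumes trace: "a \<in> carrier A \<Longrightarrow> b \<in> carrier A \<Longrightarrow> \<tau> (a \<otimes> b) = \<tau> (b \<otimes> a)"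
    and faithful: "a \<in> carrier A \<Longrightarrow> \<tau> (adj A a \<otimes> a) = 0 \<Longrightarrow> a = \<zero>"


section \<open>Non-commutative polynomials and strong convergence\<close>

text \<open>
  A polynomial in non-commuting indeterminates is a finitely supported function from words to
  coefficients; the indeterminates are numbered from 0.
\<close>

type_synonym nc_poly = "nat list \<Rightarrow>\<^sub>0 complex"

definition nc_polys :: "nat \<Rightarrow> nc_poly set" where
  "nc_polys N = {p. Poly_Mapping.keys p \<subseteq> lists {..<N}}"

definition word_prod :: "('a, 'm) monoid_scheme \<Rightarrow> 'a list \<Rightarrow> 'a" where
  "word_prod A w = foldr (mult A) w (one A)"

definition poly_eval :: "'a cstar_struct \<Rightarrow> (nat \<Rightarrow> 'a) \<Rightarrow> nc_poly \<Rightarrow> 'a" where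
  "poly_eval A a p =
     finsum A (\<lambda>w. smult A (Poly_Mapping.lookup p w) (word_prod A (map a w))) (Poly_Mapping.keys p)"

text \<open>
  For an \<open>m\<close>-tuple \<open>x\<close> (indices below \<open>m\<close>), the \<open>2 * m\<close>-tuple \<open>(x, x\<^sup>*)\<close>.
\<close>

definition adjoin_adj :: "'a cstar_struct \<Rightarrow> nat \<Rightarrow> (nat \<Rightarrow> 'a) \<Rightarrow> nat \<Rightarrow> 'a" where
  "adjoin_adj A m x = (\<lambda>i. if i < m then x i else adj A (x (i - m)))"

definition strongly_converges ::
  "nat \<Rightarrow> (nat \<Rightarrow> 'a cstar_struct) \<Rightarrow> (nat \<Rightarrow> 'a \<Rightarrow> complex) \<Rightarrow> (nat \<Rightarrow> nat \<Rightarrow> 'a) \<Rightarrow>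
   'b cstar_struct \<Rightarrow> ('b \<Rightarrow> complex) \<Rightarrow> (nat \<Rightarrow> 'b) \<Rightarrow> bool" where
  "strongly_converges m An \<tau>n xn A \<tau> x \<longleftrightarrow>
     (\<forall>p\<in>nc_polys (2 * m).
        (\<lambda>n. \<tau>n n (poly_eval (An n) (adjoin_adj (An n) m (xn n)) p))
          \<longlonglongrightarrow> \<tau> (poly_eval A (adjoin_adj A m x) p) \<and>
        (\<lambda>n. nrm (An n) (poly_eval (An n) (adjoin_adj (An n) m (xn n)) p))
          \<longlonglongrightarrow> nrm A (poly_eval A (adjoin_adj A m x) p))"


section \<open>Rational expressions\<close>

text \<open>
  An element of the free algebra on an alphabet is a finitely supported function from words to
  coefficients.  Since the levels are nested recursively inside words, that function is represented
  by \<open>Comb\<close> as its graph over its support: the finite set of all pairs (word, nonzero coefficient).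
  The set \<open>rat_exprs N k\<close> is the algebra of level \<open>k\<close> over \<open>N\<close> indeterminates.
\<close>

datatype rat_expr = Poly nc_poly | Comb "(rat_letter list \<times> complex) fset"
  and rat_letter = Letter rat_expr | InvLetter rat_expr

primrec rat_exprs :: "nat \<Rightarrow> nat \<Rightarrow> rat_expr set" where
  "rat_exprs N 0 = Poly ` nc_polys N"
| "rat_exprs N (Suc k) =
     {Comb S | S. inj_on fst (fset S) \<and> 0 \<notin> snd ` fset S \<and>
        fst ` fset S \<subseteq> lists (Letter ` rat_exprs N k \<union> InvLetter ` rat_exprs N k)}"

text \<open>
  The inclusion of level \<open>k\<close> into level \<open>k + 1\<close>.  Elements of the direct limit are represented by
  elements of some level; that evaluation is compatible with the inclusion is shown below.
\<close>

definition rat_incl :: "rat_expr \<Rightarrow> rat_expr" where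
  "rat_incl r = Comb {|([Letter r], 1)|}"

lemma rat_incl_in_rat_exprs: "r \<in> rat_exprs N k \<Longrightarrow> rat_incl r \<in> rat_exprs N (Suc k)"
  by (auto simp: rat_incl_def)

text \<open>
  Evaluation at a tuple returns \<open>None\<close> where it is undefined.  The sum ranges over the words
  themselves, not over their values, since distinct words may have the same value.  The congruence
  rule is needed for the termination proof.
\<close>

lemma foldSetD_cong_imp:
  assumes "(B, z) \<in> foldSetD D f e" and "\<And>x. x \<in> B \<Longrightarrow> f x = g x"
  shows "(B, z) \<in> foldSetD D g e"
  using assms
proof (induction rule: foldSetD.induct)
  case (insertI x B y)
  then have "(insert x B, g x y) \<in> foldSetD D g e"
    by (intro foldSetD.insertI) auto
  then show ?case using insertI.prems by simp
qed (auto intro: foldSetD.emptyI)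

lemma finsum_fundef_cong [fundef_cong]:
  assumes "B = C" and "\<And>x. x \<in> C \<Longrightarrow> f x = g x"
  shows "finsum G f B = finsum G g C"
proof -
  have "(C, z) \<in> foldSetD D (mult (add_monoid G) \<circ> f) e \<longleftrightarrow>
        (C, z) \<in> foldSetD D (mult (add_monoid G) \<circ> g) e" for z D e
    using foldSetD_cong_imp[of C z D "mult (add_monoid G) \<circ> f" e "mult (add_monoid G) \<circ> g"]
      foldSetD_cong_imp[of C z D "mult (add_monoid G) \<circ> g" e "mult (add_monoid G) \<circ> f"]
      assms(2)
    by auto
  then show ?thesis
    by (simp add: assms(1) finsum_def finprod_def foldD_def)
qed

lemma size_letter_less:
  assumes "wc \<in> fset S" and "l \<in> set (fst wc)"
  shows "size l < size (Comb S)"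
proof -
  let ?g = "size_prod (size_list snd) (\<lambda>_. 0) :: (rat_letter \<times> nat) list \<times> complex \<Rightarrow> nat"
  let ?h = "map_prod (map (\<lambda>l. (l, size l))) (\<lambda>c. c)
    :: rat_letter list \<times> complex \<Rightarrow> (rat_letter \<times> nat) list \<times> complex"
  have "(l, size l) \<in> set (map (\<lambda>l. (l, size l)) (fst wc))"
    unfolding set_map using assms(2) by (rule imageI)
  then have "size l \<le> size_list snd (map (\<lambda>l. (l, size l)) (fst wc))"
    by (rule size_list_estimation') simp
  also have "\<dots> \<le> Suc (?g (?h wc))"
    by (cases wc) simp
  also have "\<dots> \<le> (\<Sum>y\<in>?h ` fset S. Suc (?g y))"
    by (rule member_le_sum[OF imageI[OF assms(1)]]) simp_all
  finally show ?thesis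
    by simp
qed

function rat_eval :: "'a cstar_struct \<Rightarrow> (nat \<Rightarrow> 'a) \<Rightarrow> rat_expr \<Rightarrow> 'a option"
  and letter_eval :: "'a cstar_struct \<Rightarrow> (nat \<Rightarrow> 'a) \<Rightarrow> rat_letter \<Rightarrow> 'a option" where
  "rat_eval A a (Poly p) = Some (poly_eval A a p)"
| "rat_eval A a (Comb S) =
     (if \<forall>wc\<in>fset S. \<forall>l\<in>set (fst wc). letter_eval A a l \<noteq> None
      then Some (finsum A
        (\<lambda>wc. smult A (snd wc) (word_prod A (map (\<lambda>l. the (letter_eval A a l)) (fst wc)))) (fset S))
      else None)"
| "letter_eval A a (Letter r) = rat_eval A a r"
| "letter_eval A a (InvLetter r) =
     (case rat_eval A a r of
        None \<Rightarrow> None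
      | Some b \<Rightarrow> if b \<in> Units A then Some (m_inv A b) else None)"
  by pat_completeness auto
termination
  by (relation "measure (case_sum (\<lambda>(_, _, r). size r) (\<lambda>(_, _, l). size l))")
    (simp_all add: size_letter_less del: rat_expr.size)

definition in_domain :: "'a cstar_struct \<Rightarrow> (nat \<Rightarrow> 'a) \<Rightarrow> rat_expr \<Rightarrow> bool" where
  "in_domain A a r \<longleftrightarrow> rat_eval A a r \<noteq> None"

definition rat_value :: "'a cstar_struct \<Rightarrow> (nat \<Rightarrow> 'a) \<Rightarrow> rat_expr \<Rightarrow> 'a" where
  "rat_value A a r = the (rat_eval A a r)"

context unital_cstar_algebra
begin

lemma word_prod_closed: "set w \<subseteq> carrier A \<Longrightarrow> word_prod A w \<in> carrier A"
  by (induction w) (auto simp: word_prod_def)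

end

lemma rat_eval_closed:
  assumes "unital_cstar_algebra A" and "\<And>i. i < N \<Longrightarrow> a i \<in> carrier A"
  shows "r \<in> rat_exprs N k \<Longrightarrow> rat_eval A a r = Some b \<Longrightarrow> b \<in> carrier A"
proof (induction k arbitrary: r b)
  case 0
  interpret unital_cstar_algebra A by fact
  from 0 obtain p where p: "r = Poly p" "p \<in> nc_polys N" by auto
  have "word_prod A (map a w) \<in> carrier A" if "w \<in> Poly_Mapping.keys p" for w
    using that p(2) assms(2) by (intro word_prod_closed) (auto simp: nc_polys_def)
  then show ?case
    using 0 p by (auto simp: poly_eval_def intro!: finsum_closed smult_closed)
next
  case (Suc k)
  interpret unital_cstar_algebra A by fact
  from Suc.prems obtain S where S: "r = Comb S"
    and letters: "fst ` fset S \<subseteq> lists (Letter ` rat_exprs N k \<union> InvLetter ` rat_exprs N k)"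
    by auto
  from Suc.prems(2) have dom: "\<forall>wc\<in>fset S. \<forall>l\<in>set (fst wc). letter_eval A a l \<noteq> None"
    by (auto simp: S split: if_splits)
  have *: "the (letter_eval A a l) \<in> carrier A" if wc: "wc \<in> fset S" "l \<in> set (fst wc)" for l wc
  proof -
    obtain v where v: "letter_eval A a l = Some v"
      using dom wc by blast
    have "l \<in> Letter ` rat_exprs N k \<union> InvLetter ` rat_exprs N k"
      using wc letters by blast
    then consider q where "l = Letter q" "q \<in> rat_exprs N k"
      | q where "l = InvLetter q" "q \<in> rat_exprs N k"
      by blast
    then have "v \<in> carrier A"
    proof cases
      case 1
      then show ?thesis using Suc.IH[of q v] v by simp
    next
      case 2
      then show ?thesis using v by (simp split: option.splits if_splits) (metis Units_inv_closed)
    qed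
    then show ?thesis using v by simp
  qed
  have "b = finsum A (\<lambda>wc. smult A (snd wc)
      (word_prod A (map (\<lambda>l. the (letter_eval A a l)) (fst wc)))) (fset S)"
    using Suc.prems(2) dom by (simp add: S)
  also have "\<dots> \<in> carrier A"
    using * by (intro finsum_closed Pi_I smult_closed word_prod_closed subsetI)
      (simp only: set_map, blast)
  finally show ?case .
qed

lemma rat_eval_rat_incl:
  assumes "unital_cstar_algebra A" and "\<And>i. i < N \<Longrightarrow> a i \<in> carrier A" and "r \<in> rat_exprs N k"
  shows "rat_eval A a (rat_incl r) = rat_eval A a r"
proof (cases "rat_eval A a r")
  case None
  then show ?thesis by (simp add: rat_incl_def)
next
  case (Some b)
  interpret unital_cstar_algebra A by fact
  have "b \<in> carrier A"
    using rat_eval_closed[OF assms(1,2,3) Some] by simp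
  then show ?thesis
    using Some by (simp add: rat_incl_def word_prod_def smult_one)
qed

end

theory Submission
  imports Defs
begin

text \<open>
  Pairs (sequence, limit) that are approximated simultaneously, up to any \<open>\<epsilon>\<close>, by one and the same
  polynomial in \<open>(x, x\<^sup>*)\<close> are stable under the algebra operations and the adjoint, and strong
  convergence passes from polynomials to all such pairs.  The point is stability under inversion.
  If \<open>y\<close> is invertible, then \<open>h = y\<^sup>* y\<close> is self-adjoint and invertible, so for small \<open>\<delta> > 0\<close> the
  element \<open>h\<^sup>2 - \<delta>\<close> is still the square of a self-adjoint one, which gives \<open>\<parallel>1 - t h\<^sup>2\<parallel> < 1\<close> for
  some \<open>t > 0\<close>.  By convergence of norms the same inequality holds, with a uniform bound, for almost
  all \<open>n\<close>, so the Neumann series in \<open>1 - t h\<^sup>2\<close> converges uniformly in \<open>n\<close> and provides approximable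
  left inverses; right inverses come from \<open>y\<^sup>*\<close>.
\<close>

section \<open>Square roots and Neumann series in unital C*-algebras\<close>

text \<open>The algebras vary with \<open>n\<close>, and strong convergence transports only norms
  and traces of polynomials. Invertibility therefore has to be turned into a strict norm inequality
  in the limit algebra: such an inequality persists for almost all \<open>n\<close>, with a margin
  independent of \<open>n\<close>. Positivity appears in one form only, as being the square of a
  self-adjoint element. This is why \<open>h\<^sup>2\<close>, and not \<open>h\<close>, is compared
  with a scalar: \<open>h\<^sup>2 - \<delta>\<close> is the square of \<open>h v\<close>, where
  \<open>v\<close> is a self-adjoint square root of \<open>1 - \<delta> h\<^sup>-\<^sup>2\<close>
  that commutes with \<open>h\<close>. The roots in use are those of \<open>1 - z\<close> with
  \<open>z\<close> self-adjoint of norm below 1, and they come from a contracting iteration. The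
  same roots bound a state by a fixed multiple of the norm, which is how the traces follow the
  approximation.\<close>

context unital_cstar_algebra
begin

section \<open>Arithmetic of scalars, adjoints and norms\<close>

lemmas alg_closed [simp, intro] = smult_closed adj_closed

lemma smult_zero_left [simp]: "a \<in> carrier A \<Longrightarrow> 0 \<odot> a = \<zero>"
  using smult_l_distr[of a 0 0] by (simp add: add.l_cancel_one')

lemma smult_uminus_left: "a \<in> carrier A \<Longrightarrow> (- c) \<odot> a = \<ominus> (c \<odot> a)"
  using smult_l_distr[of a "-c" c] by (simp add: minus_equality)

lemma smult_zero_right [simp]: "c \<odot> \<zero> = \<zero>"
  using smult_r_distr[of \<zero> \<zero> c] by (simp add: add.l_cancel_one')

lemma smult_uminus_right: "a \<in> carrier A \<Longrightarrow> c \<odot> (\<ominus> a) = \<ominus> (c \<odot> a)"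
  using smult_r_distr[of "\<ominus> a" a c] by (simp add: minus_equality l_neg)

lemma smult_minus_right:
  "a \<in> carrier A \<Longrightarrow> b \<in> carrier A \<Longrightarrow> c \<odot> (a \<ominus> b) = c \<odot> a \<ominus> c \<odot> b"
  by (simp add: minus_eq smult_r_distr smult_uminus_right)

lemma adj_zero [simp]: "adj A \<zero> = \<zero>"
  using adj_smult[of \<zero> 0] by simp

lemma adj_uminus: "a \<in> carrier A \<Longrightarrow> adj A (\<ominus> a) = \<ominus> adj A a"
  using adj_add[of "\<ominus> a" a] by (simp add: minus_equality l_neg)

lemma adj_minus:
  "a \<in> carrier A \<Longrightarrow> b \<in> carrier A \<Longrightarrow> adj A (a \<ominus> b) = adj A a \<ominus> adj A b"
  by (simp add: minus_eq adj_add adj_uminus)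

lemma adj_one [simp]: "adj A \<one> = \<one>"
  using adj_mult[of "adj A \<one>" \<one>] adj_adj[of \<one>] by simp

lemma nrm_zero [simp]: "nrm A \<zero> = 0"
  using nrm_smult[of \<zero> 0] by simp

lemma nrm_uminus: "a \<in> carrier A \<Longrightarrow> nrm A (\<ominus> a) = nrm A a"
  using nrm_smult[of a "-1"] by (simp add: smult_uminus_left smult_one)

lemma nrm_minus_commute:
  "a \<in> carrier A \<Longrightarrow> b \<in> carrier A \<Longrightarrow> nrm A (a \<ominus> b) = nrm A (b \<ominus> a)"
  using nrm_uminus[of "a \<ominus> b"] by (simp add: minus_eq minus_add a_comm)

lemma nrm_triangle_minus:
  "a \<in> carrier A \<Longrightarrow> b \<in> carrier A \<Longrightarrow> nrm A (a \<ominus> b) \<le> nrm A a + nrm A b"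
  using nrm_triangle[of a "\<ominus> b"] by (simp add: minus_eq nrm_uminus)

lemma nrm_dist_triangle:
  assumes "a \<in> carrier A" "b \<in> carrier A" "c \<in> carrier A"
  shows "nrm A (a \<ominus> c) \<le> nrm A (a \<ominus> b) + nrm A (b \<ominus> c)"
proof -
  have "a \<ominus> c = (a \<ominus> b) \<oplus> (b \<ominus> c)"
    using assms by algebra
  then show ?thesis using assms by (simp add: nrm_triangle)
qed

lemma nrm_triangle_dist:
  assumes "a \<in> carrier A" "b \<in> carrier A"
  shows "nrm A a \<le> nrm A b + nrm A (a \<ominus> b)"
proof -
  have "a = b \<oplus> (a \<ominus> b)"
    using assms by algebra
  then show ?thesis using assms nrm_triangle[of b "a \<ominus> b"] by simp
qed

text \<open>The C*-identity and submultiplicativity give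
  \<open>(nrm A a)\<^sup>2 \<le> nrm A (adj A a) * nrm A a\<close>, and one factor cancels unless it
  is 0. Applied to \<open>adj A a\<close> as well, this yields \<open>nrm_adj\<close>.\<close>

lemma nrm_le_nrm_adj: "a \<in> carrier A \<Longrightarrow> nrm A a \<le> nrm A (adj A a)"
  using cstar_identity[of a] nrm_mult[of "adj A a" a] nrm_nonneg[of a] nrm_nonneg[of "adj A a"]
  by (cases "nrm A a = 0") (auto simp: power2_eq_square)

lemma nrm_adj: "a \<in> carrier A \<Longrightarrow> nrm A (adj A a) = nrm A a"
  using nrm_le_nrm_adj[of a] nrm_le_nrm_adj[of "adj A a"] by (simp add: adj_adj)

text \<open>The C*-identity makes \<open>nrm A \<one>\<close> equal to its own square. Equality with
  1 may fail, as the zero ring satisfies the axioms.\<close>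

lemma nrm_one_le: "nrm A \<one> \<le> 1"
  using cstar_identity[of \<one>] by (cases "nrm A \<one> = 0") (auto simp: power2_eq_square)

text \<open>The difference is \<open>(a \<ominus> c) \<otimes> b \<oplus> c \<otimes> (b \<ominus>
  d)\<close>; the norm of \<open>b\<close> is then replaced by that of \<open>d\<close> plus an
  error, so that only the reference pair \<open>c\<close>, \<open>d\<close> needs a bound.\<close>

lemma nrm_mult_diff:
  assumes "a \<in> carrier A" "b \<in> carrier A" "c \<in> carrier A" "d \<in> carrier A"
  shows "nrm A (a \<otimes> b \<ominus> c \<otimes> d)
    \<le> nrm A (a \<ominus> c) * (nrm A d + nrm A (b \<ominus> d)) + nrm A c * nrm A (b \<ominus> d)"
proof -
  have "a \<otimes> b \<ominus> c \<otimes> d = (a \<ominus> c) \<otimes> b \<oplus> c \<otimes> (b \<ominus> d)"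
    using assms by algebra
  also have "nrm A \<dots> \<le> nrm A ((a \<ominus> c) \<otimes> b) + nrm A (c \<otimes> (b \<ominus> d))"
    using assms by (simp add: nrm_triangle)
  also have "\<dots> \<le> nrm A (a \<ominus> c) * nrm A b + nrm A c * nrm A (b \<ominus> d)"
    using assms by (intro add_mono nrm_mult) auto
  also have "\<dots> \<le> nrm A (a \<ominus> c) * (nrm A d + nrm A (b \<ominus> d)) + nrm A c * nrm A (b \<ominus> d)"
    using assms by (intro add_right_mono mult_left_mono nrm_triangle_dist nrm_nonneg) auto
  finally show ?thesis .
qed

section \<open>Norm convergence and completeness\<close>

definition nrm_tendsto :: "(nat \<Rightarrow> 'a) \<Rightarrow> 'a \<Rightarrow> bool" where
  "nrm_tendsto s l \<longleftrightarrow> range s \<subseteq> carrier A \<and> l \<in> carrier A \<and> (\<lambda>i. nrm A (s i \<ominus> l)) \<longlonglongrightarrow> 0"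

lemma nrm_tendsto_closed:
  "nrm_tendsto s l \<Longrightarrow> s i \<in> carrier A" "nrm_tendsto s l \<Longrightarrow> l \<in> carrier A"
  by (auto simp: nrm_tendsto_def)

lemma nrm_tendsto_sandwich:
  assumes "\<And>i. s i \<in> carrier A" "l \<in> carrier A"
    and "\<And>i. nrm A (s i \<ominus> l) \<le> b i" "b \<longlonglongrightarrow> 0"
  shows "nrm_tendsto s l"
  unfolding nrm_tendsto_def using assms
  by (auto intro!: tendsto_sandwich[OF _ _ tendsto_const assms(4)] always_eventually nrm_nonneg)

lemma nrm_tendsto_const: "a \<in> carrier A \<Longrightarrow> nrm_tendsto (\<lambda>_. a) a"
  by (simp add: nrm_tendsto_def r_neg minus_eq)

lemma minus_eq_zero_iff:
  assumes "a \<in> carrier A" "b \<in> carrier A"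
  shows "a \<ominus> b = \<zero> \<longleftrightarrow> a = b"
proof
  assume *: "a \<ominus> b = \<zero>"
  have "a = (a \<ominus> b) \<oplus> b"
    using assms by algebra
  then show "a = b"
    using assms by (simp add: *)
qed (use assms in \<open>simp add: minus_eq r_neg\<close>)

lemma nrm_tendsto_unique:
  assumes "nrm_tendsto s l" "nrm_tendsto s k"
  shows "l = k"
proof -
  note c = nrm_tendsto_closed[OF assms(1)] nrm_tendsto_closed[OF assms(2)]
  have "(\<lambda>i. nrm A (s i \<ominus> l) + nrm A (s i \<ominus> k)) \<longlonglongrightarrow> 0 + 0"
    using assms by (intro tendsto_add) (auto simp: nrm_tendsto_def)
  moreover have "nrm A (l \<ominus> k) \<le> nrm A (s i \<ominus> l) + nrm A (s i \<ominus> k)" for i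
    using nrm_dist_triangle[of l "s i" k] nrm_minus_commute[of l "s i"] c by simp
  ultimately have "nrm A (l \<ominus> k) \<le> 0"
    by (intro LIMSEQ_le_const) auto
  then have "nrm A (l \<ominus> k) = 0"
    using nrm_nonneg[of "l \<ominus> k"] c by simp
  then show ?thesis
    using nrm_eq_0[of "l \<ominus> k"] c by (simp add: minus_eq_zero_iff)
qed

lemma nrm_tendsto_Suc: "nrm_tendsto s l \<Longrightarrow> nrm_tendsto (\<lambda>i. s (Suc i)) l"
  by (auto simp: nrm_tendsto_def intro: LIMSEQ_Suc)

lemma nrm_tendsto_add:
  assumes "nrm_tendsto s l" "nrm_tendsto t k"
  shows "nrm_tendsto (\<lambda>i. s i \<oplus> t i) (l \<oplus> k)"
proof (rule nrm_tendsto_sandwich)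
  note c = nrm_tendsto_closed[OF assms(1)] nrm_tendsto_closed[OF assms(2)]
  show "s i \<oplus> t i \<in> carrier A" "l \<oplus> k \<in> carrier A" for i
    using c by auto
  show "nrm A (s i \<oplus> t i \<ominus> (l \<oplus> k)) \<le> nrm A (s i \<ominus> l) + nrm A (t i \<ominus> k)" for i
  proof -
    have "s i \<in> carrier A" "t i \<in> carrier A" "l \<in> carrier A" "k \<in> carrier A"
      using c by auto
    moreover from this have "s i \<oplus> t i \<ominus> (l \<oplus> k) = (s i \<ominus> l) \<oplus> (t i \<ominus> k)"
      by algebra
    ultimately show ?thesis by (simp add: nrm_triangle)
  qed
  show "(\<lambda>i. nrm A (s i \<ominus> l) + nrm A (t i \<ominus> k)) \<longlonglongrightarrow> 0"
    using assms unfolding nrm_tendsto_def by (intro tendsto_add_zero) auto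
qed

lemma nrm_tendsto_mult:
  assumes "nrm_tendsto s l" "nrm_tendsto t k"
  shows "nrm_tendsto (\<lambda>i. s i \<otimes> t i) (l \<otimes> k)"
proof (rule nrm_tendsto_sandwich)
  note c = nrm_tendsto_closed[OF assms(1)] nrm_tendsto_closed[OF assms(2)]
  show "s i \<otimes> t i \<in> carrier A" "l \<otimes> k \<in> carrier A" for i
    using c by auto
  show "nrm A (s i \<otimes> t i \<ominus> l \<otimes> k)
    \<le> nrm A (s i \<ominus> l) * (nrm A k + nrm A (t i \<ominus> k)) + nrm A l * nrm A (t i \<ominus> k)" for i
    using c by (intro nrm_mult_diff) auto
  have "(\<lambda>i. nrm A (s i \<ominus> l) * (nrm A k + nrm A (t i \<ominus> k)) + nrm A l * nrm A (t i \<ominus> k))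
    \<longlonglongrightarrow> 0 * (nrm A k + 0) + nrm A l * 0"
    using assms unfolding nrm_tendsto_def by (intro tendsto_intros) auto
  then show "(\<lambda>i. nrm A (s i \<ominus> l) * (nrm A k + nrm A (t i \<ominus> k)) + nrm A l * nrm A (t i \<ominus> k))
    \<longlonglongrightarrow> 0"
    by simp
qed

lemma nrm_tendsto_smult:
  assumes "nrm_tendsto s l"
  shows "nrm_tendsto (\<lambda>i. c \<odot> s i) (c \<odot> l)"
proof -
  have "nrm A (c \<odot> s i \<ominus> c \<odot> l) = cmod c * nrm A (s i \<ominus> l)" for i
    using nrm_tendsto_closed[OF assms] by (simp flip: smult_minus_right add: nrm_smult)
  then show ?thesis
    using assms by (auto simp: nrm_tendsto_def intro!: tendsto_mult_right_zero)
qed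

lemma nrm_tendsto_adj:
  assumes "nrm_tendsto s l"
  shows "nrm_tendsto (\<lambda>i. adj A (s i)) (adj A l)"
proof -
  have "nrm A (adj A (s i) \<ominus> adj A l) = nrm A (s i \<ominus> l)" for i
    using nrm_tendsto_closed[OF assms] by (simp flip: adj_minus add: nrm_adj)
  then show ?thesis
    using assms by (auto simp: nrm_tendsto_def)
qed

text \<open>Completeness enters here, for square roots and Neumann series alike. The error bound
  depends on \<open>C\<close>, \<open>\<rho>\<close> and \<open>i\<close> alone, which later lets
  one truncation order serve almost all algebras of the sequence.\<close>

lemma geometric_convergence:
  assumes s: "\<And>i. s i \<in> carrier A" and \<rho>: "0 \<le> \<rho>" "\<rho> < 1" and C: "0 \<le> C"
    and step: "\<And>i. nrm A (s (Suc i) \<ominus> s i) \<le> C * \<rho> ^ i"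
  obtains l where "nrm_tendsto s l" "\<And>i. nrm A (s i \<ominus> l) \<le> C * \<rho> ^ i / (1 - \<rho>)"
proof -
  \<comment> \<open>Telescoping; the partial geometric sum is kept exact so that the induction on
    \<open>d\<close> closes.\<close>
  have far: "nrm A (s (i + d) \<ominus> s i) \<le> C * \<rho> ^ i * (1 - \<rho> ^ d) / (1 - \<rho>)" for i d
  proof (induction d)
    case 0
    then show ?case using s by (simp add: minus_eq r_neg)
  next
    case (Suc d)
    have "nrm A (s (i + Suc d) \<ominus> s i)
      \<le> nrm A (s (Suc (i + d)) \<ominus> s (i + d)) + nrm A (s (i + d) \<ominus> s i)"
      using nrm_dist_triangle[OF s s s] by simp
    also have "\<dots> \<le> C * \<rho> ^ (i + d) + C * \<rho> ^ i * (1 - \<rho> ^ d) / (1 - \<rho>)"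
      using step Suc by (intro add_mono)
    also have "\<dots> = C * \<rho> ^ i * (1 - \<rho> ^ Suc d) / (1 - \<rho>)"
      using \<rho> by (simp add: field_simps power_add)
    finally show ?case .
  qed
  have bound: "nrm A (s j \<ominus> s i) \<le> C * \<rho> ^ i / (1 - \<rho>)" if "i \<le> j" for i j
  proof -
    have "C * \<rho> ^ i * (1 - \<rho> ^ (j - i)) / (1 - \<rho>) \<le> C * \<rho> ^ i / (1 - \<rho>)"
      using \<rho> C by (intro divide_right_mono mult_left_le) auto
    then show ?thesis
      using far[of i "j - i"] that by simp
  qed
  have lim0: "(\<lambda>i. C * \<rho> ^ i / (1 - \<rho>)) \<longlonglongrightarrow> 0"
    using \<rho> tendsto_mult_right_zero[OF LIMSEQ_power_zero[of \<rho>], of "C / (1 - \<rho>)"] by simp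
  have "\<exists>N. \<forall>i\<ge>N. \<forall>j\<ge>N. nrm A (s i \<ominus> s j) < e" if "e > 0" for e
  proof -
    obtain N where N: "\<And>i. i \<ge> N \<Longrightarrow> C * \<rho> ^ i / (1 - \<rho>) < e"
      using order_tendstoD(2)[OF lim0 \<open>e > 0\<close>] by (auto simp: eventually_sequentially)
    have "nrm A (s i \<ominus> s j) < e" if "i \<ge> N" "j \<ge> N" for i j
    proof (cases "i \<le> j")
      case True
      then show ?thesis
        using bound[OF True] N[of i] that nrm_minus_commute[of "s i" "s j"] s by simp
    next
      case False
      then show ?thesis using bound[of j i] N[of j] that by simp
    qed
    then show ?thesis by blast
  qed
  then obtain l where l: "l \<in> carrier A" "(\<lambda>i. nrm A (s i \<ominus> l)) \<longlonglongrightarrow> 0"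
    using complete[of s] s by (metis (no_types, lifting) image_subsetI)
  show thesis
  proof
    show "nrm_tendsto s l"
      using l s by (auto simp: nrm_tendsto_def)
    \<comment> \<open>Follows from \<open>bound\<close> by letting \<open>j\<close> tend to infinity
      with \<open>i\<close> fixed.\<close>
    show "nrm A (s i \<ominus> l) \<le> C * \<rho> ^ i / (1 - \<rho>)" for i
    proof (rule LIMSEQ_le_const)
      show "(\<lambda>j. C * \<rho> ^ i / (1 - \<rho>) + nrm A (s j \<ominus> l)) \<longlonglongrightarrow> C * \<rho> ^ i / (1 - \<rho>)"
        using tendsto_add[OF tendsto_const l(2)] by simp
      have "nrm A (s i \<ominus> l) \<le> C * \<rho> ^ i / (1 - \<rho>) + nrm A (s j \<ominus> l)" if "i \<le> j" for j
        using bound[OF that] nrm_dist_triangle[of "s i" "s j" l] nrm_minus_commute[of "s i" "s j"]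
          s l(1) by simp
      then show "\<exists>N. \<forall>j\<ge>N. nrm A (s i \<ominus> l) \<le> C * \<rho> ^ i / (1 - \<rho>) + nrm A (s j \<ominus> l)"
        by blast
    qed
  qed
qed

section \<open>Square roots and a norm criterion for invertible self-adjoint elements\<close>

lemmas smult_smult = smult_assoc[symmetric]

text \<open>With \<open>v = 1 - l\<close> the equation \<open>v\<^sup>2 = 1 - z\<close> becomes the
  fixed point equation \<open>l = (z + l\<^sup>2) / 2\<close>. Iteration from 0 stays in the ball of
  radius \<open>\<rho> = nrm A z\<close>, where the map contracts with factor
  \<open>\<rho> < 1\<close>. Self-adjointness, and commutation with anything that commutes with
  \<open>z\<close>, hold for every iterate and pass to the limit. The commutation clause is what
  later makes a product \<open>h \<otimes> v\<close> self-adjoint.\<close>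

lemma ex_sqrt_one_minus:
  assumes z: "z \<in> carrier A" and sa: "adj A z = z" and less: "nrm A z < 1"
  obtains v where "v \<in> carrier A" "adj A v = v" "v \<otimes> v = \<one> \<ominus> z"
    "\<And>u. u \<in> carrier A \<Longrightarrow> u \<otimes> z = z \<otimes> u \<Longrightarrow> u \<otimes> v = v \<otimes> u"
proof -
  define \<rho> where "\<rho> = nrm A z"
  have \<rho>: "0 \<le> \<rho>" "\<rho> < 1"
    using nrm_nonneg[OF z] less by (auto simp: \<rho>_def)
  define w where "w = rec_nat \<zero> (\<lambda>_ w. (1/2) \<odot> (z \<oplus> w \<otimes> w))"
  have w0: "w 0 = \<zero>" and wSuc: "\<And>i. w (Suc i) = (1/2) \<odot> (z \<oplus> w i \<otimes> w i)"
    by (simp_all add: w_def)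
  have wc: "w i \<in> carrier A" for i
    by (induction i) (auto simp: w0 wSuc z)
  have wbound: "nrm A (w i) \<le> \<rho>" for i
  proof (induction i)
    case 0
    then show ?case using \<rho> by (simp add: w0)
  next
    case (Suc i)
    have "nrm A (z \<oplus> w i \<otimes> w i) \<le> nrm A z + nrm A (w i \<otimes> w i)"
      using wc z by (simp add: nrm_triangle)
    also have "nrm A (w i \<otimes> w i) \<le> nrm A (w i) * nrm A (w i)"
      using wc by (simp add: nrm_mult)
    also have "\<dots> \<le> \<rho> * 1"
      using Suc \<rho> wc by (intro mult_mono nrm_nonneg) auto
    finally show ?case
      using wc z by (simp add: wSuc nrm_smult \<rho>_def)
  qed
  have step: "nrm A (w (Suc i) \<ominus> w i) \<le> 1 * \<rho> ^ i" for i
  proof (induction i)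
    case 0
    then show ?case using wc wbound[of 1] \<rho> by (simp add: w0 minus_eq)
  next
    case (Suc i)
    \<comment> \<open>The difference of squares is split without commuting the iterates; each of the
      two terms contributes \<open>\<rho>\<close> times the previous bound, and the factor 1/2
      compensates for their number.\<close>
    let ?d = "w (Suc i) \<ominus> w i"
    have "(z \<oplus> w (Suc i) \<otimes> w (Suc i)) \<ominus> (z \<oplus> w i \<otimes> w i) = ?d \<otimes> w (Suc i) \<oplus> w i \<otimes> ?d"
      using wc[of i] wc[of "Suc i"] z by algebra
    then have "w (Suc (Suc i)) \<ominus> w (Suc i) = (1/2) \<odot> (?d \<otimes> w (Suc i) \<oplus> w i \<otimes> ?d)"
      using wc z by (simp add: wSuc[of "Suc i"]) (simp add: wSuc[of i] flip: smult_minus_right)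
    then have "nrm A (w (Suc (Suc i)) \<ominus> w (Suc i))
        = 1/2 * nrm A (?d \<otimes> w (Suc i) \<oplus> w i \<otimes> ?d)"
      using wc by (simp add: nrm_smult)
    also have "\<dots> \<le> 1/2 * (nrm A (?d \<otimes> w (Suc i)) + nrm A (w i \<otimes> ?d))"
      using wc by (intro mult_left_mono nrm_triangle) auto
    also have "\<dots> \<le> 1/2 * (nrm A ?d * nrm A (w (Suc i)) + nrm A (w i) * nrm A ?d)"
      using wc by (intro mult_left_mono add_mono nrm_mult) auto
    also have "\<dots> \<le> 1/2 * (\<rho> ^ i * \<rho> + \<rho> * \<rho> ^ i)"
      using wc Suc wbound \<rho> by (intro mult_left_mono add_mono mult_mono nrm_nonneg) auto
    finally show ?case by simp
  qed
  obtain l where l: "nrm_tendsto w l"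
    using geometric_convergence[OF wc \<rho> _ step] by auto
  have lc [simp]: "l \<in> carrier A"
    using l by (rule nrm_tendsto_closed)
  have "nrm_tendsto (\<lambda>i. w (Suc i)) ((1/2) \<odot> (z \<oplus> l \<otimes> l))"
    unfolding wSuc
    by (intro nrm_tendsto_smult nrm_tendsto_add nrm_tendsto_mult nrm_tendsto_const z l)
  with nrm_tendsto_Suc[OF l] have fix_eq: "l = (1/2) \<odot> (z \<oplus> l \<otimes> l)"
    by (rule nrm_tendsto_unique)
  have adjw: "adj A (w i) = w i" for i
    by (induction i) (use wc z in \<open>auto simp: w0 wSuc adj_smult adj_add adj_mult sa\<close>)
  have adjl: "adj A l = l"
    using nrm_tendsto_adj[OF l] l by (auto simp: adjw intro: nrm_tendsto_unique)
  \<comment> \<open>Clears the factor 1/2 from the fixed point equation, ready for expanding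
    \<open>(\<one> \<ominus> l) \<otimes> (\<one> \<ominus> l)\<close>.\<close>
  have "l \<oplus> l = 2 \<odot> l"
    using smult_l_distr[of l 1 1] by (simp add: smult_one)
  also have "\<dots> = z \<oplus> l \<otimes> l"
    using z by (subst fix_eq) (simp add: smult_smult smult_one)
  finally have double: "l \<oplus> l = z \<oplus> l \<otimes> l" .
  have commute: "u \<otimes> l = l \<otimes> u" if u: "u \<in> carrier A" "u \<otimes> z = z \<otimes> u" for u
  proof -
    have "u \<otimes> w i = w i \<otimes> u" for i
    proof (induction i)
      case (Suc i)
      have "u \<otimes> (w i \<otimes> w i) = (w i \<otimes> w i) \<otimes> u"
        using Suc wc[of i] u(1) by (metis m_assoc)
      then show ?case
        using wc u z by (simp add: wSuc smult_mult_left smult_mult_right r_distr l_distr)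
    qed (use u in \<open>simp add: w0\<close>)
    then have "nrm_tendsto (\<lambda>i. u \<otimes> w i) (l \<otimes> u)"
      using nrm_tendsto_mult[OF l nrm_tendsto_const[OF u(1)]] by simp
    with nrm_tendsto_mult[OF nrm_tendsto_const[OF u(1)] l] show ?thesis
      by (rule nrm_tendsto_unique)
  qed
  show thesis
  proof
    show "\<one> \<ominus> l \<in> carrier A" by simp
    show "adj A (\<one> \<ominus> l) = \<one> \<ominus> l"
      by (simp add: adj_minus adjl)
    have "(\<one> \<ominus> l) \<otimes> (\<one> \<ominus> l) = \<one> \<ominus> (l \<oplus> l) \<oplus> l \<otimes> l"
      using lc by (simp add: minus_eq l_distr r_distr l_minus r_minus minus_add a_ac)
    also have "\<dots> = \<one> \<ominus> z"
      unfolding double using lc z by algebra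
    finally show "(\<one> \<ominus> l) \<otimes> (\<one> \<ominus> l) = \<one> \<ominus> z" .
    show "u \<otimes> (\<one> \<ominus> l) = (\<one> \<ominus> l) \<otimes> u" if "u \<in> carrier A" "u \<otimes> z = z \<otimes> u" for u
      using commute[OF that] that lc by (simp add: minus_eq r_distr l_distr r_minus l_minus)
  qed
qed

text \<open>
  Completing the self-adjoint contraction \<open>u\<close> to the unitary \<open>u + \<i> v\<close> with \<open>v\<^sup>2 = 1 - u\<^sup>2\<close> bounds
  \<open>v\<close> by 1, without any spectral theory.
\<close>

lemma nrm_one_minus_square_le:
  assumes u: "u \<in> carrier A" and sa: "adj A u = u" and less: "nrm A u < 1"
  shows "nrm A (\<one> \<ominus> u \<otimes> u) \<le> 1"
proof -
  have "nrm A (u \<otimes> u) \<le> nrm A u * nrm A u"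
    using u by (simp add: nrm_mult)
  also have "\<dots> \<le> nrm A u * 1"
    using less u by (intro mult_left_mono nrm_nonneg) auto
  finally have "nrm A (u \<otimes> u) < 1"
    using less by simp
  moreover have "u \<otimes> u \<in> carrier A" "adj A (u \<otimes> u) = u \<otimes> u"
    using u by (simp_all add: adj_mult sa)
  ultimately obtain v where v: "v \<in> carrier A" "adj A v = v" "v \<otimes> v = \<one> \<ominus> u \<otimes> u"
    and comm: "\<And>b. b \<in> carrier A \<Longrightarrow> b \<otimes> (u \<otimes> u) = (u \<otimes> u) \<otimes> b \<Longrightarrow> b \<otimes> v = v \<otimes> b"
    using ex_sqrt_one_minus[of "u \<otimes> u"] by blast
  \<comment> \<open>\<open>u\<close> commutes with its own square and hence with \<open>v\<close>;
    this cancels the mixed terms in \<open>adj A U \<otimes> U\<close>.\<close>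
  have uv: "u \<otimes> v = v \<otimes> u"
    using comm[of u] u by (simp add: m_assoc)
  define U where "U = u \<oplus> \<i> \<odot> v"
  have Uc: "U \<in> carrier A"
    using u v by (simp add: U_def)
  have adjU: "adj A U = u \<oplus> (- \<i>) \<odot> v"
    using u v by (simp add: U_def adj_add adj_smult sa)
  have "adj A U \<otimes> U = u \<otimes> u \<oplus> v \<otimes> v"
  proof -
    have "a \<oplus> \<ominus> b \<oplus> (b \<oplus> c) = a \<oplus> c"
      if "a \<in> carrier A" "b \<in> carrier A" "c \<in> carrier A" for a b c
      using that by algebra
    moreover have "adj A U \<otimes> U
        = u \<otimes> u \<oplus> \<ominus> (\<i> \<odot> (v \<otimes> u)) \<oplus> (\<i> \<odot> (v \<otimes> u) \<oplus> v \<otimes> v)"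
      unfolding adjU unfolding U_def using u v(1)
      by (simp add: l_distr r_distr smult_mult_left smult_mult_right uv smult_smult smult_one
          smult_uminus_left[of "v \<otimes> u"] smult_r_distr)
    ultimately show ?thesis
      using u v(1) by simp
  qed
  also have "\<dots> = \<one>"
    unfolding v(3) using u by algebra
  finally have "(nrm A U)\<^sup>2 \<le> 1"
    using cstar_identity[OF Uc] nrm_one_le by simp
  then have nU: "nrm A U \<le> 1"
    using power2_le_imp_le[of "nrm A U" 1] by simp
  \<comment> \<open>\<open>v\<close> is the imaginary part of \<open>U\<close>, and both
    \<open>U\<close> and its adjoint have norm at most 1.\<close>
  have "U \<ominus> adj A U = \<i> \<odot> v \<oplus> \<i> \<odot> v"
  proof -
    have "(a \<oplus> b) \<ominus> (a \<oplus> \<ominus> b) = b \<oplus> b" if "a \<in> carrier A" "b \<in> carrier A" for a b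
      using that by algebra
    then show ?thesis
      unfolding adjU unfolding U_def using u v(1) by (simp add: smult_uminus_left)
  qed
  also have "\<dots> = (2 * \<i>) \<odot> v"
    using smult_l_distr[of v \<i> \<i>] v by simp
  finally have "2 * nrm A v = nrm A (U \<ominus> adj A U)"
    using v(1) by (simp add: nrm_smult norm_mult)
  also have "\<dots> \<le> 2"
    using nrm_triangle_minus[OF Uc, of "adj A U"] Uc nU by (simp add: nrm_adj)
  finally have nv: "nrm A v \<le> 1" by simp
  have "nrm A (v \<otimes> v) \<le> nrm A v * nrm A v"
    using v(1) by (simp add: nrm_mult)
  also have "\<dots> \<le> 1"
    using nv v(1) nrm_nonneg[of v] by (simp add: mult_le_one)
  finally show ?thesis
    by (simp add: v(3))
qed

text \<open>Heuristically the spectrum of \<open>h\<^sup>2\<close> lies in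
  \<open>[\<delta>, T]\<close>, so that of \<open>1 - h\<^sup>2 / T\<close> lies in
  \<open>[0, 1 - \<delta> / T]\<close>. Algebraically, with
  \<open>g\<^sup>2 = h\<^sup>2 - \<delta>\<close>, \<open>u = g / C\<close> and
  \<open>T = C\<^sup>2 + \<delta>\<close> one has
  \<open>1 - h\<^sup>2 / T = (C\<^sup>2 / T) (1 - u\<^sup>2)\<close>. The last factor has norm at
  most 1, and \<open>C\<^sup>2 / T < 1\<close> because \<open>\<delta> > 0\<close>.\<close>

lemma ex_nrm_one_minus_square_less:
  assumes h: "h \<in> Units A" and sa: "adj A h = h"
  obtains t :: real where "0 < t" "nrm A (\<one> \<ominus> t \<odot> (h \<otimes> h)) < 1"
proof -
  have hc [simp]: "h \<in> carrier A"
    using h by auto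
  define k where "k = inv h"
  have kc [simp]: "k \<in> carrier A" and hk: "h \<otimes> k = \<one>" and kh: "k \<otimes> h = \<one>"
    using h by (auto simp: k_def)
  have adjk: "adj A k = k"
  proof -
    have "adj A k \<otimes> h = \<one>" using adj_mult[of h k] by (simp add: hk sa)
    then show ?thesis
      using inv_unique[OF _ hk, of "adj A k"] by simp
  qed
  \<comment> \<open>The summand 1 avoids division by zero and makes the norm of
    \<open>\<delta> k\<^sup>2\<close> strictly less than 1.\<close>
  define \<delta> where "\<delta> = 1 / (nrm A (k \<otimes> k) + 1)"
  have \<delta>: "\<delta> > 0" "\<delta> * nrm A (k \<otimes> k) < 1"
    using nrm_nonneg[of "k \<otimes> k"] by (auto simp: \<delta>_def field_simps)
  define z where "z = complex_of_real \<delta> \<odot> (k \<otimes> k)"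
  have zc [simp]: "z \<in> carrier A"
    by (simp add: z_def)
  have zprops: "adj A z = z" "nrm A z < 1"
    using \<delta> by (simp_all add: z_def adj_smult adj_mult adjk nrm_smult)
  obtain v where v: "v \<in> carrier A" "adj A v = v" "v \<otimes> v = \<one> \<ominus> z"
    and comm: "\<And>u. u \<in> carrier A \<Longrightarrow> u \<otimes> z = z \<otimes> u \<Longrightarrow> u \<otimes> v = v \<otimes> u"
    using ex_sqrt_one_minus[OF zc zprops] by blast
  have "h \<otimes> z = z \<otimes> h"
  proof -
    have "h \<otimes> (k \<otimes> k) = (k \<otimes> k) \<otimes> h"
      by (simp add: m_assoc kh) (simp add: hk flip: m_assoc)
    then show ?thesis by (simp add: z_def smult_mult_left smult_mult_right)
  qed
  then have hv: "h \<otimes> v = v \<otimes> h"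
    by (rule comm[OF hc])
  define g where "g = h \<otimes> v"
  have gc [simp]: "g \<in> carrier A"
    using v by (simp add: g_def)
  have adjg: "adj A g = g"
    using v by (simp add: g_def adj_mult sa hv)
  have gg: "g \<otimes> g = h \<otimes> h \<ominus> complex_of_real \<delta> \<odot> \<one>"
  proof -
    have "g \<otimes> g = h \<otimes> (v \<otimes> h) \<otimes> v"
      using v(1) by (simp add: g_def m_assoc)
    also have "\<dots> = (h \<otimes> h) \<otimes> (v \<otimes> v)"
      unfolding hv[symmetric] using v(1) by (simp add: m_assoc)
    also have "\<dots> = h \<otimes> h \<ominus> (h \<otimes> h) \<otimes> z"
      unfolding v(3) by (simp add: minus_eq r_distr r_minus)
    also have "(h \<otimes> h) \<otimes> z = complex_of_real \<delta> \<odot> \<one>"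
    proof -
      have "(h \<otimes> h) \<otimes> (k \<otimes> k) = h \<otimes> (h \<otimes> k) \<otimes> k"
        by (simp add: m_assoc)
      then show ?thesis
        by (simp add: z_def smult_mult_right hk)
    qed
    finally show ?thesis .
  qed
  \<comment> \<open>Strictly above \<open>nrm A g\<close>, hence positive, so that \<open>u\<close>
    has norm below 1 as \<open>nrm_one_minus_square_le\<close> requires.\<close>
  define C where "C = nrm A g + 1"
  have C: "C > 0" "nrm A g < C"
    using nrm_nonneg[of g] by (auto simp: C_def)
  define u where "u = complex_of_real (1 / C) \<odot> g"
  have "nrm A (\<one> \<ominus> u \<otimes> u) \<le> 1"
    using C by (intro nrm_one_minus_square_le)
      (auto simp: u_def adj_smult adjg nrm_smult norm_divide)
  define T where "T = C\<^sup>2 + \<delta>"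
  have T: "T > 0"
    using \<delta> C by (simp add: T_def add_pos_pos)
  have "\<one> \<ominus> complex_of_real (1 / T) \<odot> (h \<otimes> h) = complex_of_real (C\<^sup>2 / T) \<odot> (\<one> \<ominus> u \<otimes> u)"
  proof -
    have uu: "u \<otimes> u = complex_of_real (1 / C\<^sup>2) \<odot> (g \<otimes> g)"
      by (simp add: u_def smult_mult_left smult_mult_right smult_smult power2_eq_square)
    have "complex_of_real (C\<^sup>2 / T) \<odot> (\<one> \<ominus> u \<otimes> u)
      = complex_of_real (C\<^sup>2 / T) \<odot> \<one> \<ominus> complex_of_real (1 / T) \<odot> (g \<otimes> g)"
      using C by (simp add: uu smult_minus_right smult_smult)
    also have "\<dots> = complex_of_real (C\<^sup>2 / T) \<odot> \<one>
        \<ominus> (complex_of_real (1 / T) \<odot> (h \<otimes> h) \<ominus> complex_of_real (\<delta> / T) \<odot> \<one>)"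
      by (simp add: gg smult_minus_right smult_smult)
    also have "\<dots> = (complex_of_real (C\<^sup>2 / T) \<odot> \<one> \<oplus> complex_of_real (\<delta> / T) \<odot> \<one>)
        \<ominus> complex_of_real (1 / T) \<odot> (h \<otimes> h)"
    proof -
      have "\<And>a b c. a \<in> carrier A \<Longrightarrow> b \<in> carrier A \<Longrightarrow> c \<in> carrier A \<Longrightarrow>
        a \<ominus> (b \<ominus> c) = (a \<oplus> c) \<ominus> b"
        by algebra
      then show ?thesis by simp
    qed
    also have "complex_of_real (C\<^sup>2 / T) \<odot> \<one> \<oplus> complex_of_real (\<delta> / T) \<odot> \<one> = \<one>"
    proof -
      have "complex_of_real (C\<^sup>2 / T) + complex_of_real (\<delta> / T) = complex_of_real ((C\<^sup>2 + \<delta>) / T)"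
        by (simp add: add_divide_distrib)
      also have "\<dots> = 1" using T by (simp add: T_def)
      finally show ?thesis
        by (simp add: smult_one flip: smult_l_distr)
    qed
    finally show ?thesis by simp
  qed
  then have "nrm A (\<one> \<ominus> complex_of_real (1 / T) \<odot> (h \<otimes> h))
    = C\<^sup>2 / T * nrm A (\<one> \<ominus> u \<otimes> u)"
    using T by (simp add: nrm_smult u_def norm_divide norm_power)
  also have "\<dots> \<le> C\<^sup>2 / T * 1"
    using \<open>nrm A (\<one> \<ominus> u \<otimes> u) \<le> 1\<close> T by (intro mult_left_mono) auto
  also have "\<dots> < 1"
    using T \<delta> by (simp add: T_def)
  finally show thesis
    using T that[of "1 / T"] by simp
qed

text \<open>Horner form of \<open>1 + z + ... + z^(K-1)\<close>, where \<open>K\<close> counts the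
  terms. The recursion uses only sums and products, so approximability of the partial sums is an
  induction on \<open>K\<close>.\<close>

primrec neumann_sum :: "'a \<Rightarrow> nat \<Rightarrow> 'a" where
  "neumann_sum z 0 = \<zero>"
| "neumann_sum z (Suc K) = \<one> \<oplus> neumann_sum z K \<otimes> z"

lemma neumann_sum_closed [simp]: "z \<in> carrier A \<Longrightarrow> neumann_sum z K \<in> carrier A"
  by (induction K) auto

text \<open>The error bound involves \<open>\<rho>\<close> but neither \<open>z\<close> nor the
  algebra, so a common bound on norms gives a common rate. The inverse comes out on the left because
  the recursion multiplies by \<open>z\<close> on the right.\<close>

lemma neumann_series:
  assumes z [simp]: "z \<in> carrier A" and \<rho>: "nrm A z \<le> \<rho>" "\<rho> < 1"
  obtains g where "g \<in> carrier A" "g \<otimes> (\<one> \<ominus> z) = \<one>"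
    "\<And>K. nrm A (neumann_sum z K \<ominus> g) \<le> \<rho> ^ K / (1 - \<rho>)"
proof -
  let ?s = "neumann_sum z"
  have \<rho>0: "0 \<le> \<rho>"
    using nrm_nonneg[OF z] \<rho> by simp
  have step: "nrm A (?s (Suc i) \<ominus> ?s i) \<le> 1 * \<rho> ^ i" for i
  proof (induction i)
    case 0
    then show ?case using nrm_one_le by (simp add: minus_eq)
  next
    case (Suc i)
    have "(\<one> \<oplus> b \<otimes> z) \<ominus> (\<one> \<oplus> a \<otimes> z) = (b \<ominus> a) \<otimes> z"
      if "a \<in> carrier A" "b \<in> carrier A" for a b
      using that z by algebra
    from this[of "?s i" "?s (Suc i)"]
    have "?s (Suc (Suc i)) \<ominus> ?s (Suc i) = (?s (Suc i) \<ominus> ?s i) \<otimes> z"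
      by simp
    also have "nrm A \<dots> \<le> nrm A (?s (Suc i) \<ominus> ?s i) * nrm A z"
      by (intro nrm_mult) auto
    also have "\<dots> \<le> \<rho> ^ i * \<rho>"
      using Suc \<rho>(1) \<rho>0 by (intro mult_mono nrm_nonneg) auto
    finally show ?case by (simp add: mult.commute)
  qed
  obtain g where g: "nrm_tendsto ?s g" "\<And>i. nrm A (?s i \<ominus> g) \<le> 1 * \<rho> ^ i / (1 - \<rho>)"
    using geometric_convergence[OF neumann_sum_closed[OF z] \<rho>0 \<rho>(2) _ step] by auto
  have gc [simp]: "g \<in> carrier A"
    using g by (auto dest: nrm_tendsto_closed)
  \<comment> \<open>The limit of the recursion is \<open>g = \<one> \<oplus> g \<otimes> z\<close>,
    which rearranges to the claim.\<close>
  have "nrm_tendsto (\<lambda>i. ?s (Suc i)) (\<one> \<oplus> g \<otimes> z)"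
    by (simp, intro nrm_tendsto_add nrm_tendsto_mult nrm_tendsto_const g) auto
  with nrm_tendsto_Suc[OF g(1)] have eq: "g = \<one> \<oplus> g \<otimes> z"
    by (rule nrm_tendsto_unique)
  have "g \<otimes> (\<one> \<ominus> z) = g \<ominus> g \<otimes> z"
    by (simp add: minus_eq r_distr r_minus)
  also have "\<dots> = (\<one> \<oplus> g \<otimes> z) \<ominus> g \<otimes> z"
    using eq by simp
  also have "\<dots> = \<one>"
    using m_closed[OF gc z] one_closed by algebra
  finally show thesis
    using that[of g] g(2) by simp
qed

end

section \<open>Boundedness of states\<close>

context cstar_probability_space
begin

lemma state_minus: "a \<in> carrier A \<Longrightarrow> b \<in> carrier A \<Longrightarrow> \<tau> (a \<ominus> b) = \<tau> a - \<tau> b"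
  using state_smult[of b "-1"] state_add[of a "\<ominus> b"]
  by (simp add: minus_eq smult_uminus_left smult_one)

text \<open>For \<open>s > nrm A b\<close> the element \<open>1 - b / s\<close> is the square of a
  self-adjoint one, so its state is a nonnegative real. This forces \<open>\<tau> b\<close> to be
  real and at most \<open>s\<close>, and \<open>s\<close> may decrease to
  \<open>nrm A b\<close>.\<close>

lemma state_selfadjoint_le:
  assumes b: "b \<in> carrier A" and sa: "adj A b = b"
  shows "\<tau> b \<in> \<real>" "Re (\<tau> b) \<le> nrm A b"
proof -
  have *: "\<tau> b \<in> \<real> \<and> Re (\<tau> b) \<le> s" if s: "s > nrm A b" for s
  proof -
    have s0: "s > 0"
      using s nrm_nonneg[OF b] by simp
    define z where "z = complex_of_real (1 / s) \<odot> b"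
    have "z \<in> carrier A" "adj A z = z" "nrm A z < 1"
      using b sa s s0 by (simp_all add: z_def adj_smult nrm_smult norm_divide)
    then obtain v where "v \<in> carrier A" "adj A v = v" "v \<otimes> v = \<one> \<ominus> z"
      using ex_sqrt_one_minus by blast
    then have "\<tau> (\<one> \<ominus> z) \<in> \<real>\<^sub>\<ge>\<^sub>0"
      using state_positive[of v] by simp
    moreover have "\<tau> (\<one> \<ominus> z) = 1 - \<tau> b / complex_of_real s"
      using b by (simp add: state_minus state_unital z_def state_smult)
    ultimately have "1 - \<tau> b / complex_of_real s \<in> \<real>\<^sub>\<ge>\<^sub>0"
      by simp
    then have "0 \<le> 1 - Re (\<tau> b) / s \<and> Im (\<tau> b) = 0"
      using s0 by (simp add: complex_nonneg_Reals_iff)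
    then show ?thesis
      using s0 by (simp add: complex_is_Real_iff)
  qed
  show "\<tau> b \<in> \<real>"
    using *[of "nrm A b + 1"] by simp
  show "Re (\<tau> b) \<le> nrm A b"
    using * by (meson dense_ge)
qed

lemma state_selfadjoint_bound:
  assumes b: "b \<in> carrier A" and sa: "adj A b = b"
  shows "cmod (\<tau> b) \<le> nrm A b"
proof -
  have "\<tau> (\<ominus> b) = - \<tau> b"
    using state_smult[of b "-1"] b by (simp add: smult_uminus_left smult_one)
  then have "- Re (\<tau> b) \<le> nrm A b"
    using state_selfadjoint_le(2)[of "\<ominus> b"] b sa by (simp add: adj_uminus nrm_uminus)
  then have "\<bar>Re (\<tau> b)\<bar> \<le> nrm A b"
    using state_selfadjoint_le(2)[OF assms] by simp
  then show ?thesis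
    using state_selfadjoint_le(1)[OF assms] by (auto elim!: Reals_cases)
qed

text \<open>The constant comes from \<open>2 a = b - \<i> c\<close> with \<open>b\<close>,
  \<open>c\<close> self-adjoint of norm at most twice that of \<open>a\<close>. What matters is its
  independence of the algebra: the traces are uniformly Lipschitz along the sequence.\<close>

lemma state_bound:
  assumes a: "a \<in> carrier A"
  shows "cmod (\<tau> a) \<le> 2 * nrm A a"
proof -
  define b c where "b = a \<oplus> adj A a" and "c = \<i> \<odot> (a \<ominus> adj A a)"
  have bc: "b \<in> carrier A" "c \<in> carrier A"
    using a by (simp_all add: b_def c_def)
  have sa: "adj A b = b" "adj A c = c"
  proof -
    show "adj A b = b"
      using a by (simp add: b_def adj_add adj_adj a_comm)
    have "adj A a \<ominus> a = \<ominus> (a \<ominus> adj A a)"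
      using a by (simp add: minus_eq minus_add a_comm)
    then show "adj A c = c"
      using a by (simp add: c_def adj_smult adj_minus adj_adj smult_uminus_left smult_uminus_right)
  qed
  have bound: "nrm A b \<le> 2 * nrm A a" "nrm A c \<le> 2 * nrm A a"
    using nrm_triangle[of a "adj A a"] nrm_triangle_minus[of a "adj A a"] a
    by (simp_all add: b_def c_def nrm_smult nrm_adj)
  have "2 * \<tau> a = \<tau> b - \<i> * \<tau> c"
    using a by (simp add: b_def c_def state_add state_minus state_smult algebra_simps)
  then have "2 * cmod (\<tau> a) = cmod (\<tau> b - \<i> * \<tau> c)"
    by (metis norm_mult norm_numeral)
  also have "\<dots> \<le> cmod (\<tau> b) + cmod (\<tau> c)"
    using norm_triangle_ineq4[of "\<tau> b" "\<i> * \<tau> c"] by (simp add: norm_mult)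
  also have "\<dots> \<le> 2 * nrm A a + 2 * nrm A a"
    using state_selfadjoint_bound[of b] state_selfadjoint_bound[of c] bc sa bound by simp
  finally show ?thesis by simp
qed

end

section \<open>Evaluation of non-commutative polynomials\<close>

lemma nc_polys_add: "p \<in> nc_polys N \<Longrightarrow> q \<in> nc_polys N \<Longrightarrow> p + q \<in> nc_polys N"
  using keys_add[of p q] by (auto simp: nc_polys_def)

lemma nc_polys_zero: "0 \<in> nc_polys N"
  by (simp add: nc_polys_def)

lemma nc_polys_sum: "(\<And>i. i \<in> I \<Longrightarrow> p i \<in> nc_polys N) \<Longrightarrow> sum p I \<in> nc_polys N"
  by (induction I rule: infinite_finite_induct) (auto intro: nc_polys_add nc_polys_zero)

lemma nc_polys_single: "w \<in> lists {..<N} \<Longrightarrow> Poly_Mapping.single w c \<in> nc_polys N"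
  by (auto simp: nc_polys_def)

lemma nc_polys_keys: "p \<in> nc_polys N \<Longrightarrow> w \<in> Poly_Mapping.keys p \<Longrightarrow> w \<in> lists {..<N}"
  by (auto simp: nc_polys_def)

text \<open>The product of the free algebra, written as a sum of monomials so that its evaluation
  reduces to \<open>poly_eval_sum\<close> and \<open>poly_eval_single\<close>.\<close>

definition nc_mult :: "nc_poly \<Rightarrow> nc_poly \<Rightarrow> nc_poly" where
  "nc_mult p q = (\<Sum>u\<in>Poly_Mapping.keys p. \<Sum>v\<in>Poly_Mapping.keys q.
     Poly_Mapping.single (u @ v) (Poly_Mapping.lookup p u * Poly_Mapping.lookup q v))"

text \<open>Indeterminate \<open>i + m\<close> stands for the adjoint of indeterminate
  \<open>i < m\<close>; this is the induced involution on the indices below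
  \<open>2 * m\<close>.\<close>

definition swap_index :: "nat \<Rightarrow> nat \<Rightarrow> nat" where
  "swap_index m i = (if i < m then i + m else i - m)"

text \<open>The formal adjoint; words are reversed because the adjoint is
  antimultiplicative.\<close>

definition nc_star :: "nat \<Rightarrow> nc_poly \<Rightarrow> nc_poly" where
  "nc_star m p = (\<Sum>u\<in>Poly_Mapping.keys p.
     Poly_Mapping.single (rev (map (swap_index m) u)) (cnj (Poly_Mapping.lookup p u)))"

lemma nc_polys_mult: "p \<in> nc_polys N \<Longrightarrow> q \<in> nc_polys N \<Longrightarrow> nc_mult p q \<in> nc_polys N"
  unfolding nc_mult_def
  by (intro nc_polys_sum nc_polys_single) (auto dest: nc_polys_keys)

lemma swap_word: "w \<in> lists {..<2 * m} \<Longrightarrow> rev (map (swap_index m) w) \<in> lists {..<2 * m}"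
  by (auto simp: swap_index_def in_lists_conv_set)

lemma nc_polys_star: "p \<in> nc_polys (2 * m) \<Longrightarrow> nc_star m p \<in> nc_polys (2 * m)"
  unfolding nc_star_def
  by (intro nc_polys_sum nc_polys_single swap_word) (auto dest: nc_polys_keys)

context unital_cstar_algebra
begin

lemma word_prod_Nil: "word_prod A [] = \<one>"
  by (simp add: word_prod_def)

lemma word_prod_Cons: "word_prod A (b # w) = b \<otimes> word_prod A w"
  by (simp add: word_prod_def)

lemma word_prod_append:
  "set u \<subseteq> carrier A \<Longrightarrow> set v \<subseteq> carrier A \<Longrightarrow> word_prod A (u @ v) = word_prod A u \<otimes> word_prod A v"
  by (induction u) (auto simp: word_prod_Nil word_prod_Cons word_prod_closed m_assoc)

lemma adj_word_prod:
  "set w \<subseteq> carrier A \<Longrightarrow> adj A (word_prod A w) = word_prod A (rev (map (adj A) w))"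
proof (induction w)
  case (Cons b w)
  then have "set (rev (map (adj A) w)) \<subseteq> carrier A"
    by auto
  with Cons show ?case
    by (simp add: word_prod_Cons word_prod_Nil word_prod_append word_prod_closed adj_mult)
qed (simp add: word_prod_Nil)

lemma adj_finsum:
  "f \<in> I \<rightarrow> carrier A \<Longrightarrow> adj A (finsum A f I) = finsum A (\<lambda>i. adj A (f i)) I"
  by (induction I rule: infinite_finite_induct) (auto simp: adj_add Pi_def)

lemma nrm_add_diff:
  assumes "a \<in> carrier A" "b \<in> carrier A" "c \<in> carrier A" "d \<in> carrier A"
  shows "nrm A (a \<oplus> b \<ominus> (c \<oplus> d)) \<le> nrm A (a \<ominus> c) + nrm A (b \<ominus> d)"
proof -
  have "a \<oplus> b \<ominus> (c \<oplus> d) = (a \<ominus> c) \<oplus> (b \<ominus> d)"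
    using assms by algebra
  then show ?thesis
    using assms by (simp add: nrm_triangle)
qed

lemma adj_Units: "y \<in> Units A \<Longrightarrow> adj A y \<in> Units A"
proof -
  assume y: "y \<in> Units A"
  then have "adj A (inv y) \<otimes> adj A y = \<one>" "adj A y \<otimes> adj A (inv y) = \<one>"
    by (simp_all add: Units_closed flip: adj_mult)
  moreover have "adj A y \<in> carrier A" "adj A (inv y) \<in> carrier A"
    using y by auto
  ultimately show "adj A y \<in> Units A"
    by (auto simp: Units_def)
qed

text \<open>Assuming \<open>\<delta> \<le> 1\<close> absorbs the second-order error: \<open>\<delta>
  (M + \<delta>) + M \<delta> \<le> \<delta> (2 M + 1)\<close>.\<close>

lemma nrm_mult_diff_le:
  assumes "a \<in> carrier A" "b \<in> carrier A" "c \<in> carrier A" "d \<in> carrier A"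
    and "nrm A c \<le> M" "nrm A d \<le> M" "nrm A (a \<ominus> c) \<le> \<delta>" "nrm A (b \<ominus> d) \<le> \<delta>" "\<delta> \<le> 1"
  shows "nrm A (a \<otimes> b \<ominus> c \<otimes> d) \<le> \<delta> * (2 * M + 1)"
proof -
  have nonneg: "0 \<le> nrm A (a \<ominus> c)" "0 \<le> nrm A (b \<ominus> d)" "0 \<le> nrm A c" "0 \<le> nrm A d"
    using assms(1-4) by (auto intro: nrm_nonneg)
  have "nrm A (a \<otimes> b \<ominus> c \<otimes> d)
    \<le> nrm A (a \<ominus> c) * (nrm A d + nrm A (b \<ominus> d)) + nrm A c * nrm A (b \<ominus> d)"
    by (rule nrm_mult_diff) fact+
  also have "\<dots> \<le> \<delta> * (M + 1) + M * \<delta>"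
    using assms(5-9) nonneg by (intro add_mono mult_mono) auto
  finally show ?thesis by (simp add: algebra_simps)
qed

text \<open>The assumption has the shape that the Neumann series for
  \<open>z = 1 - c h\<^sup>2\<close> with \<open>h = y\<^sup>* y\<close> delivers: \<open>g\<close>
  is a left inverse of \<open>c h\<^sup>2\<close>. Since \<open>h\<^sup>2 = h y\<^sup>* y\<close>,
  regrouping leaves \<open>y\<close> as the last factor.\<close>

lemma left_inverse_of_square:
  assumes y [simp]: "y \<in> carrier A" and g [simp]: "g \<in> carrier A"
    and inv: "g \<otimes> (\<one> \<ominus> (\<one> \<ominus> c \<odot> ((adj A y \<otimes> y) \<otimes> (adj A y \<otimes> y)))) = \<one>"
  shows "(g \<otimes> (c \<odot> ((adj A y \<otimes> y) \<otimes> adj A y))) \<otimes> y = \<one>"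
proof -
  have "\<one> \<ominus> (\<one> \<ominus> b) = b" if "b \<in> carrier A" for b
    using that one_closed by algebra
  then have "g \<otimes> (c \<odot> ((adj A y \<otimes> y) \<otimes> (adj A y \<otimes> y))) = \<one>"
    using inv by simp
  then show ?thesis
    by (simp add: m_assoc smult_mult_left)
qed

lemma inv_eq_left: "g \<in> carrier A \<Longrightarrow> y \<in> Units A \<Longrightarrow> g \<otimes> y = \<one> \<Longrightarrow> inv y = g"
  by (metis Units_closed Units_inv_closed Units_r_inv inv_unique)

lemma Units_if_left_right_inverse:
  assumes "y \<in> carrier A" "g \<in> carrier A" "k \<in> carrier A" "g \<otimes> y = \<one>" "y \<otimes> k = \<one>"
  shows "y \<in> Units A" "inv y = g"
proof -
  have "g = g \<otimes> (y \<otimes> k)"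
    using assms by simp
  also have "\<dots> = k"
    using assms(1-4) by (simp flip: m_assoc)
  finally have "y \<otimes> g = \<one>"
    using assms by simp
  then show "y \<in> Units A" "inv y = g"
    using assms by (auto simp: Units_def intro: inv_char)
qed

end

section \<open>Evaluation respects sums, products and adjoints\<close>

locale cstar_tuple = unital_cstar_algebra A for A :: "'a cstar_struct" (structure) +
  fixes N :: nat and a :: "nat \<Rightarrow> 'a"
  assumes a_closed: "i < N \<Longrightarrow> a i \<in> carrier A"
begin

lemma set_word_closed: "w \<in> lists {..<N} \<Longrightarrow> set (map a w) \<subseteq> carrier A"
  using a_closed by auto

lemma word_closed: "w \<in> lists {..<N} \<Longrightarrow> word_prod A (map a w) \<in> carrier A"
  using set_word_closed by (rule word_prod_closed)

text \<open>Keys may vanish by cancellation in a sum, or for a monomial with coefficient 0; summing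
  over a fixed larger set of words avoids these cases.\<close>

lemma poly_eval_superset:
  assumes "finite F" "Poly_Mapping.keys p \<subseteq> F" "F \<subseteq> lists {..<N}"
  shows "poly_eval A a p = (\<Oplus>w\<in>F. Poly_Mapping.lookup p w \<odot> word_prod A (map a w))"
  unfolding poly_eval_def
proof (rule add.finprod_mono_neutral_cong_left)
  show "(\<lambda>w. Poly_Mapping.lookup p w \<odot> word_prod A (map a w)) \<in> F \<rightarrow> carrier A"
    using assms(3) by (auto intro!: word_closed smult_closed)
  show "Poly_Mapping.lookup p w \<odot> word_prod A (map a w) = \<zero>" if "w \<in> F - Poly_Mapping.keys p" for w
  proof -
    have "word_prod A (map a w) \<in> carrier A"
      using that assms(3) by (intro word_closed) auto
    moreover have "Poly_Mapping.lookup p w = 0"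
      using that by (simp add: in_keys_iff)
    ultimately show ?thesis by simp
  qed
qed (use assms in auto)

lemma poly_eval_closed: "p \<in> nc_polys N \<Longrightarrow> poly_eval A a p \<in> carrier A"
  unfolding poly_eval_def
  by (intro finsum_closed Pi_I smult_closed word_closed) (rule nc_polys_keys)

lemma poly_eval_add:
  assumes "p \<in> nc_polys N" "q \<in> nc_polys N"
  shows "poly_eval A a (p + q) = poly_eval A a p \<oplus> poly_eval A a q"
proof -
  define F where "F = Poly_Mapping.keys p \<union> Poly_Mapping.keys q"
  have F: "finite F" "F \<subseteq> lists {..<N}"
    using assms by (auto simp: F_def dest: nc_polys_keys)
  have W: "word_prod A (map a w) \<in> carrier A" if "w \<in> F" for w
    using that F by (intro word_closed) auto
  have "poly_eval A a (p + q)
    = (\<Oplus>w\<in>F. Poly_Mapping.lookup (p + q) w \<odot> word_prod A (map a w))"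
    using F keys_add[of p q] by (intro poly_eval_superset) (auto simp: F_def)
  also have "\<dots> = (\<Oplus>w\<in>F. Poly_Mapping.lookup p w \<odot> word_prod A (map a w)
      \<oplus> Poly_Mapping.lookup q w \<odot> word_prod A (map a w))"
    using W by (intro finsum_cong') (auto simp: lookup_add smult_l_distr)
  also have "\<dots> = (\<Oplus>w\<in>F. Poly_Mapping.lookup p w \<odot> word_prod A (map a w))
      \<oplus> (\<Oplus>w\<in>F. Poly_Mapping.lookup q w \<odot> word_prod A (map a w))"
    using W by (intro finsum_addf) auto
  also have "\<dots> = poly_eval A a p \<oplus> poly_eval A a q"
    using poly_eval_superset[OF F(1) _ F(2)] by (auto simp: F_def)
  finally show ?thesis .
qed

lemma poly_eval_zero: "poly_eval A a 0 = \<zero>"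
  by (simp add: poly_eval_def)

lemma poly_eval_single:
  assumes "w \<in> lists {..<N}"
  shows "poly_eval A a (Poly_Mapping.single w c) = c \<odot> word_prod A (map a w)"
proof -
  have "poly_eval A a (Poly_Mapping.single w c)
    = (\<Oplus>v\<in>{w}. Poly_Mapping.lookup (Poly_Mapping.single w c) v \<odot> word_prod A (map a v))"
    using assms by (intro poly_eval_superset) auto
  also have "\<dots> = c \<odot> word_prod A (map a w)"
    using word_closed[OF assms] by simp
  finally show ?thesis .
qed

lemma poly_eval_sum:
  assumes "\<And>i. i \<in> I \<Longrightarrow> p i \<in> nc_polys N"
  shows "poly_eval A a (sum p I) = (\<Oplus>i\<in>I. poly_eval A a (p i))"
  using assms
proof (induction I rule: infinite_finite_induct)
  case (insert i I)
  then have "poly_eval A a (sum p (insert i I)) = poly_eval A a (p i) \<oplus> poly_eval A a (sum p I)"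
    by (simp add: poly_eval_add nc_polys_sum)
  also have "\<dots> = (\<Oplus>i\<in>insert i I. poly_eval A a (p i))"
    using insert by (subst finsum_insert) (auto intro: poly_eval_closed)
  finally show ?case .
qed (simp_all add: poly_eval_zero)

lemma poly_eval_mult:
  assumes p: "p \<in> nc_polys N" and q: "q \<in> nc_polys N"
  shows "poly_eval A a (nc_mult p q) = poly_eval A a p \<otimes> poly_eval A a q"
proof -
  define P where "P u = Poly_Mapping.lookup p u \<odot> word_prod A (map a u)" for u
  define Q where "Q v = Poly_Mapping.lookup q v \<odot> word_prod A (map a v)" for v
  note keys = nc_polys_keys[OF p] nc_polys_keys[OF q]
  have Pc: "P u \<in> carrier A" if "u \<in> Poly_Mapping.keys p" for u
    using keys(1)[OF that] by (simp add: P_def word_closed)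
  have Qc: "Q v \<in> carrier A" if "v \<in> Poly_Mapping.keys q" for v
    using keys(2)[OF that] by (simp add: Q_def word_closed)
  have monomial: "poly_eval A a (Poly_Mapping.single (u @ v)
        (Poly_Mapping.lookup p u * Poly_Mapping.lookup q v)) = P u \<otimes> Q v"
    if "u \<in> Poly_Mapping.keys p" "v \<in> Poly_Mapping.keys q" for u v
  proof -
    note uv = keys(1)[OF that(1)] keys(2)[OF that(2)]
    have "word_prod A (map a (u @ v)) = word_prod A (map a u) \<otimes> word_prod A (map a v)"
      unfolding map_append by (intro word_prod_append set_word_closed uv)
    moreover have "u @ v \<in> lists {..<N}"
      using uv by auto
    ultimately show ?thesis
      using uv word_closed[of u] word_closed[of v]
      by (simp add: poly_eval_single P_def Q_def smult_mult_left smult_mult_right smult_smult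
          mult.commute del: in_lists_conv_set map_append)
  qed
  have nc: "Poly_Mapping.single (u @ v) c \<in> nc_polys N"
    if "u \<in> Poly_Mapping.keys p" "v \<in> Poly_Mapping.keys q" for u v c
    using keys(1)[OF that(1)] keys(2)[OF that(2)] by (intro nc_polys_single) auto
  have "poly_eval A a (nc_mult p q)
    = (\<Oplus>u\<in>Poly_Mapping.keys p. poly_eval A a (\<Sum>v\<in>Poly_Mapping.keys q.
        Poly_Mapping.single (u @ v) (Poly_Mapping.lookup p u * Poly_Mapping.lookup q v)))"
    unfolding nc_mult_def by (intro poly_eval_sum nc_polys_sum nc)
  also have "\<dots> = (\<Oplus>u\<in>Poly_Mapping.keys p. P u \<otimes> (\<Oplus>v\<in>Poly_Mapping.keys q. Q v))"
  proof (intro finsum_cong' refl)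
    show "(\<lambda>u. P u \<otimes> (\<Oplus>v\<in>Poly_Mapping.keys q. Q v)) \<in> Poly_Mapping.keys p \<rightarrow> carrier A"
      using Pc Qc by auto
    fix u assume u: "u \<in> Poly_Mapping.keys p"
    have "poly_eval A a (\<Sum>v\<in>Poly_Mapping.keys q.
        Poly_Mapping.single (u @ v) (Poly_Mapping.lookup p u * Poly_Mapping.lookup q v))
      = (\<Oplus>v\<in>Poly_Mapping.keys q. poly_eval A a (
          Poly_Mapping.single (u @ v) (Poly_Mapping.lookup p u * Poly_Mapping.lookup q v)))"
      using u by (intro poly_eval_sum nc)
    also have "\<dots> = (\<Oplus>v\<in>Poly_Mapping.keys q. P u \<otimes> Q v)"
      using u Pc Qc by (intro finsum_cong') (auto simp: monomial)
    also have "\<dots> = P u \<otimes> (\<Oplus>v\<in>Poly_Mapping.keys q. Q v)"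
      using u Pc Qc by (intro finsum_rdistr[symmetric]) auto
    finally show "poly_eval A a (\<Sum>v\<in>Poly_Mapping.keys q.
        Poly_Mapping.single (u @ v) (Poly_Mapping.lookup p u * Poly_Mapping.lookup q v))
      = P u \<otimes> (\<Oplus>v\<in>Poly_Mapping.keys q. Q v)" .
  qed
  also have "\<dots> = (\<Oplus>u\<in>Poly_Mapping.keys p. P u) \<otimes> (\<Oplus>v\<in>Poly_Mapping.keys q. Q v)"
    using Pc Qc by (intro finsum_ldistr[symmetric]) auto
  finally show ?thesis
    by (simp add: poly_eval_def P_def Q_def)
qed

lemma poly_eval_star:
  assumes N: "N = 2 * m" and p: "p \<in> nc_polys N"
    and swap: "\<And>i. i < N \<Longrightarrow> adj A (a i) = a (swap_index m i)"
  shows "poly_eval A a (nc_star m p) = adj A (poly_eval A a p)"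
proof -
  note keys = nc_polys_keys[OF p]
  have swap_keys: "rev (map (swap_index m) u) \<in> lists {..<N}"
    if "u \<in> Poly_Mapping.keys p" for u
    using swap_word keys[OF that] unfolding N .
  have word: "adj A (word_prod A (map a w)) = word_prod A (map a (rev (map (swap_index m) w)))"
    if "w \<in> lists {..<N}" for w
  proof -
    have "map (adj A) (map a w) = map a (map (swap_index m) w)"
      using that by (auto simp: swap)
    then have "rev (map (adj A) (map a w)) = map a (rev (map (swap_index m) w))"
      by (simp only: rev_map)
    then show ?thesis
      using adj_word_prod[OF set_word_closed[OF that]] by (simp only:)
  qed
  have "poly_eval A a (nc_star m p) = (\<Oplus>u\<in>Poly_Mapping.keys p. poly_eval A a
      (Poly_Mapping.single (rev (map (swap_index m) u)) (cnj (Poly_Mapping.lookup p u))))"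
    unfolding nc_star_def by (intro poly_eval_sum nc_polys_single swap_keys)
  also have "\<dots> = (\<Oplus>u\<in>Poly_Mapping.keys p.
      adj A (Poly_Mapping.lookup p u \<odot> word_prod A (map a u)))"
  proof (intro finsum_cong' refl)
    show "(\<lambda>u. adj A (Poly_Mapping.lookup p u \<odot> word_prod A (map a u)))
      \<in> Poly_Mapping.keys p \<rightarrow> carrier A"
      using word_closed[OF keys] by auto
    fix u assume u: "u \<in> Poly_Mapping.keys p"
    show "poly_eval A a
        (Poly_Mapping.single (rev (map (swap_index m) u)) (cnj (Poly_Mapping.lookup p u)))
      = adj A (Poly_Mapping.lookup p u \<odot> word_prod A (map a u))"
      using poly_eval_single[OF swap_keys[OF u]] word[OF keys[OF u]] word_closed[OF keys[OF u]]
      by (simp add: adj_smult)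
  qed
  also have "\<dots> = adj A (poly_eval A a p)"
    unfolding poly_eval_def using word_closed[OF keys] by (intro adj_finsum[symmetric]) auto
  finally show ?thesis .
qed

end

lemma adj_adjoin_adj:
  assumes "unital_cstar_algebra A" "\<And>i. i < m \<Longrightarrow> x i \<in> carrier A" "i < 2 * m"
  shows "adj A (adjoin_adj A m x i) = adjoin_adj A m x (swap_index m i)"
  using assms(2,3) unital_cstar_algebra.adj_adj[OF assms(1)]
  by (auto simp: adjoin_adj_def swap_index_def)

lemma cstar_tuple_adjoin_adj:
  assumes "unital_cstar_algebra A" "\<And>i. i < m \<Longrightarrow> x i \<in> carrier A"
  shows "cstar_tuple A (2 * m) (adjoin_adj A m x)"
proof -
  interpret unital_cstar_algebra A by fact
  show ?thesis
    by unfold_locales (use assms(2) in \<open>auto simp: adjoin_adj_def\<close>)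
qed

section \<open>Simultaneous polynomial approximation\<close>

text \<open>Norms alone govern approximability; the traces join in the final theorem as one more
  family of Lipschitz functions for \<open>approximable_tendsto\<close>.\<close>

locale nc_approximation =
  fixes An :: "nat \<Rightarrow> 'a cstar_struct" and A :: "'b cstar_struct"
    and m :: nat and xn :: "nat \<Rightarrow> nat \<Rightarrow> 'a" and x :: "nat \<Rightarrow> 'b"
  assumes An_cstar: "unital_cstar_algebra (An n)"
    and A_cstar: "unital_cstar_algebra A"
    and xn_closed: "i < m \<Longrightarrow> xn n i \<in> carrier (An n)"
    and x_closed: "i < m \<Longrightarrow> x i \<in> carrier A"
    and nrm_poly_tendsto: "p \<in> nc_polys (2 * m) \<Longrightarrow>
      (\<lambda>n. nrm (An n) (poly_eval (An n) (adjoin_adj (An n) m (xn n)) p))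
        \<longlonglongrightarrow> nrm A (poly_eval A (adjoin_adj A m x) p)"
begin

abbreviation an :: "nat \<Rightarrow> nat \<Rightarrow> 'a" where
  "an n \<equiv> adjoin_adj (An n) m (xn n)"

abbreviation a :: "nat \<Rightarrow> 'b" where
  "a \<equiv> adjoin_adj A m x"

sublocale A: cstar_tuple A "2 * m" "adjoin_adj A m x"
  by (intro cstar_tuple_adjoin_adj A_cstar x_closed)

sublocale An: cstar_tuple "An n" "2 * m" "adjoin_adj (An n) m (xn n)" for n
  by (intro cstar_tuple_adjoin_adj An_cstar xn_closed)

text \<open>
  The same polynomial has to approximate the limit and almost all members of the sequence; this
  is what makes the relation stable under inversion.
\<close>

definition approximable :: "(nat \<Rightarrow> 'a) \<Rightarrow> 'b \<Rightarrow> bool" where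
  "approximable yn y \<longleftrightarrow> y \<in> carrier A \<and> (\<forall>\<^sub>F n in sequentially. yn n \<in> carrier (An n)) \<and>
     (\<forall>e>0. \<exists>p\<in>nc_polys (2 * m). nrm A (poly_eval A a p \<ominus>\<^bsub>A\<^esub> y) < e \<and>
        (\<forall>\<^sub>F n in sequentially. nrm (An n) (poly_eval (An n) (an n) p \<ominus>\<^bsub>An n\<^esub> yn n) < e))"

lemma approximable_closed:
  assumes "approximable yn y"
  shows "y \<in> carrier A" "\<forall>\<^sub>F n in sequentially. yn n \<in> carrier (An n)"
  using assms by (auto simp: approximable_def)

lemma approximableE:
  assumes "approximable yn y" "0 < e"
  obtains p where "p \<in> nc_polys (2 * m)" "nrm A (poly_eval A a p \<ominus>\<^bsub>A\<^esub> y) < e"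
    "\<forall>\<^sub>F n in sequentially. nrm (An n) (poly_eval (An n) (an n) p \<ominus>\<^bsub>An n\<^esub> yn n) < e"
  using assms by (auto simp: approximable_def)

text \<open>Only the tail of the sequence counts. This absorbs the arbitrary values taken at those
  \<open>n\<close> where an inverse or an evaluation is undefined.\<close>

lemma approximable_cong:
  assumes "approximable yn y" and "\<forall>\<^sub>F n in sequentially. yn n = zn n"
  shows "approximable zn y"
  unfolding approximable_def
proof (intro conjI allI impI)
  show "y \<in> carrier A"
    using assms(1) by (rule approximable_closed)
  show "\<forall>\<^sub>F n in sequentially. zn n \<in> carrier (An n)"
    using approximable_closed(2)[OF assms(1)] assms(2) by eventually_elim simp
  fix e :: real assume "e > 0"
  with assms(1) obtain p where p: "p \<in> nc_polys (2 * m)" "nrm A (poly_eval A a p \<ominus>\<^bsub>A\<^esub> y) < e"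
    and ev: "\<forall>\<^sub>F n in sequentially. nrm (An n) (poly_eval (An n) (an n) p \<ominus>\<^bsub>An n\<^esub> yn n) < e"
    by (rule approximableE)
  have "\<forall>\<^sub>F n in sequentially. nrm (An n) (poly_eval (An n) (an n) p \<ominus>\<^bsub>An n\<^esub> zn n) < e"
    using ev assms(2) by eventually_elim simp
  with p show "\<exists>p\<in>nc_polys (2 * m). nrm A (poly_eval A a p \<ominus>\<^bsub>A\<^esub> y) < e \<and>
      (\<forall>\<^sub>F n in sequentially. nrm (An n) (poly_eval (An n) (an n) p \<ominus>\<^bsub>An n\<^esub> zn n) < e)"
    by blast
qed

lemma approximable_poly:
  assumes p: "p \<in> nc_polys (2 * m)"
  shows "approximable (\<lambda>n. poly_eval (An n) (an n) p) (poly_eval A a p)"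
proof -
  have "b \<ominus>\<^bsub>A\<^esub> b = \<zero>\<^bsub>A\<^esub>" if "b \<in> carrier A" for b
    using that by (simp add: A.minus_eq_zero_iff)
  moreover have "b \<ominus>\<^bsub>An n\<^esub> b = \<zero>\<^bsub>An n\<^esub>" if "b \<in> carrier (An n)" for b n
    using that by (simp add: An.minus_eq_zero_iff)
  ultimately show ?thesis
    using p A.poly_eval_closed[OF p] An.poly_eval_closed[OF p]
    by (auto simp: approximable_def intro!: bexI[of _ p])
qed

text \<open>An e/2 argument: approximable pairs are closed under uniform limits. The approximants,
  and the index from which their estimate holds, may depend on \<open>e\<close>.\<close>

lemma approximable_limit:
  assumes y: "y \<in> carrier A" and yn: "\<forall>\<^sub>F n in sequentially. yn n \<in> carrier (An n)"
    and lim: "\<And>e. e > 0 \<Longrightarrow> \<exists>fn f. approximable fn f \<and> nrm A (f \<ominus>\<^bsub>A\<^esub> y) < e \<and>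
      (\<forall>\<^sub>F n in sequentially. nrm (An n) (fn n \<ominus>\<^bsub>An n\<^esub> yn n) < e)"
  shows "approximable yn y"
  unfolding approximable_def
proof (intro conjI allI impI y yn)
  fix e :: real assume "e > 0"
  then have e2: "e / 2 > 0" by simp
  obtain fn f where f: "approximable fn f" "nrm A (f \<ominus>\<^bsub>A\<^esub> y) < e / 2"
    "\<forall>\<^sub>F n in sequentially. nrm (An n) (fn n \<ominus>\<^bsub>An n\<^esub> yn n) < e / 2"
    using lim[OF e2] by blast
  obtain p where p: "p \<in> nc_polys (2 * m)" "nrm A (poly_eval A a p \<ominus>\<^bsub>A\<^esub> f) < e / 2"
    "\<forall>\<^sub>F n in sequentially. nrm (An n) (poly_eval (An n) (an n) p \<ominus>\<^bsub>An n\<^esub> fn n) < e / 2"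
    using f(1) e2 by (rule approximableE)
  have "nrm A (poly_eval A a p \<ominus>\<^bsub>A\<^esub> y) < e"
    using A.nrm_dist_triangle[OF A.poly_eval_closed[OF p(1)] approximable_closed(1)[OF f(1)] y]
      p(2) f(2) by simp
  moreover have "\<forall>\<^sub>F n in sequentially. nrm (An n) (poly_eval (An n) (an n) p \<ominus>\<^bsub>An n\<^esub> yn n) < e"
    using p(3) f(3) yn approximable_closed(2)[OF f(1)]
  proof eventually_elim
    case (elim n)
    then show ?case
      using An.nrm_dist_triangle[OF An.poly_eval_closed[OF p(1)], of "fn n" n "yn n"] by simp
  qed
  ultimately show "\<exists>p\<in>nc_polys (2 * m). nrm A (poly_eval A a p \<ominus>\<^bsub>A\<^esub> y) < e \<and>
      (\<forall>\<^sub>F n in sequentially. nrm (An n) (poly_eval (An n) (an n) p \<ominus>\<^bsub>An n\<^esub> yn n) < e)"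
    using p(1) by blast
qed

text \<open>An e/3 argument. One Lipschitz constant for all \<open>n\<close> allows the polynomial
  to be fixed before \<open>n\<close> grows. The norm is handled with constant 1, the traces with
  constant 2.\<close>

lemma approximable_tendsto:
  fixes \<phi>n :: "nat \<Rightarrow> 'a \<Rightarrow> 'c::metric_space" and \<phi> :: "'b \<Rightarrow> 'c"
  assumes y: "approximable yn y" and C: "C > 0"
    and lip_n: "\<And>n b c. b \<in> carrier (An n) \<Longrightarrow> c \<in> carrier (An n) \<Longrightarrow>
      dist (\<phi>n n b) (\<phi>n n c) \<le> C * nrm (An n) (b \<ominus>\<^bsub>An n\<^esub> c)"
    and lip: "\<And>b c. b \<in> carrier A \<Longrightarrow> c \<in> carrier A \<Longrightarrow>
      dist (\<phi> b) (\<phi> c) \<le> C * nrm A (b \<ominus>\<^bsub>A\<^esub> c)"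
    and polys: "\<And>p. p \<in> nc_polys (2 * m) \<Longrightarrow>
      (\<lambda>n. \<phi>n n (poly_eval (An n) (an n) p)) \<longlonglongrightarrow> \<phi> (poly_eval A a p)"
  shows "(\<lambda>n. \<phi>n n (yn n)) \<longlonglongrightarrow> \<phi> y"
proof (rule tendstoI)
  fix e :: real assume e: "e > 0"
  then have "e / 3 / C > 0" using C by simp
  with y obtain p where p: "p \<in> nc_polys (2 * m)" "nrm A (poly_eval A a p \<ominus>\<^bsub>A\<^esub> y) < e / 3 / C"
    "\<forall>\<^sub>F n in sequentially. nrm (An n) (poly_eval (An n) (an n) p \<ominus>\<^bsub>An n\<^esub> yn n) < e / 3 / C"
    by (rule approximableE)
  have mid: "\<forall>\<^sub>F n in sequentially.
      dist (\<phi>n n (poly_eval (An n) (an n) p)) (\<phi> (poly_eval A a p)) < e / 3"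
    using polys[OF p(1)] e by (intro tendstoD) auto
  have "C * nrm A (poly_eval A a p \<ominus>\<^bsub>A\<^esub> y) < e / 3"
    using p(2) C by (simp add: field_simps)
  then have right: "dist (\<phi> (poly_eval A a p)) (\<phi> y) < e / 3"
    using lip[OF A.poly_eval_closed[OF p(1)] approximable_closed(1)[OF y]] by simp
  show "\<forall>\<^sub>F n in sequentially. dist (\<phi>n n (yn n)) (\<phi> y) < e"
    using mid p(3) approximable_closed(2)[OF y]
  proof eventually_elim
    case (elim n)
    let ?p = "poly_eval (An n) (an n) p"
    have "C * nrm (An n) (?p \<ominus>\<^bsub>An n\<^esub> yn n) < e / 3"
      using elim(2) C by (simp add: field_simps)
    then have "dist (\<phi>n n ?p) (\<phi>n n (yn n)) < e / 3"
      using lip_n[OF An.poly_eval_closed[OF p(1)] elim(3)] by simp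
    then show ?case
      using elim(1) right dist_triangle[of "\<phi>n n (yn n)" "\<phi> y" "\<phi>n n ?p"]
        dist_triangle[of "\<phi>n n ?p" "\<phi> y" "\<phi> (poly_eval A a p)"]
      by (simp add: dist_commute)
  qed
qed

lemma approximable_nrm:
  assumes "approximable yn y"
  shows "(\<lambda>n. nrm (An n) (yn n)) \<longlonglongrightarrow> nrm A y"
proof (rule approximable_tendsto[where \<phi>n = "\<lambda>n. nrm (An n)" and C = 1,
      OF assms zero_less_one _ _ nrm_poly_tendsto])
  show "dist (nrm (An n) b) (nrm (An n) c) \<le> 1 * nrm (An n) (b \<ominus>\<^bsub>An n\<^esub> c)"
    if "b \<in> carrier (An n)" "c \<in> carrier (An n)" for n b c
    using An.nrm_triangle_dist[OF that] An.nrm_triangle_dist[OF that(2,1)]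
      An.nrm_minus_commute[OF that] by (simp add: dist_real_def)
  show "dist (nrm A b) (nrm A c) \<le> 1 * nrm A (b \<ominus>\<^bsub>A\<^esub> c)"
    if "b \<in> carrier A" "c \<in> carrier A" for b c
    using A.nrm_triangle_dist[OF that] A.nrm_triangle_dist[OF that(2,1)]
      A.nrm_minus_commute[OF that] by (simp add: dist_real_def)
qed

section \<open>Stability under the algebra operations and the adjoint\<close>

lemma approximable_const: "approximable (\<lambda>n. c \<odot>\<^bsub>An n\<^esub> \<one>\<^bsub>An n\<^esub>) (c \<odot>\<^bsub>A\<^esub> \<one>\<^bsub>A\<^esub>)"
  using approximable_poly[OF nc_polys_single[of "[]" "2 * m" c]]
  by (simp add: A.poly_eval_single An.poly_eval_single A.word_prod_Nil An.word_prod_Nil)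

lemma approximable_one: "approximable (\<lambda>n. \<one>\<^bsub>An n\<^esub>) \<one>\<^bsub>A\<^esub>"
  using approximable_const[of 1] by (simp add: A.smult_one An.smult_one)

lemma approximable_zero: "approximable (\<lambda>n. \<zero>\<^bsub>An n\<^esub>) \<zero>\<^bsub>A\<^esub>"
  using approximable_const[of 0] by simp

lemma approximable_add:
  assumes y: "approximable yn y" and z: "approximable zn z"
  shows "approximable (\<lambda>n. yn n \<oplus>\<^bsub>An n\<^esub> zn n) (y \<oplus>\<^bsub>A\<^esub> z)"
proof (rule approximable_limit)
  note [simp] = approximable_closed(1)[OF y] approximable_closed(1)[OF z]
  show "y \<oplus>\<^bsub>A\<^esub> z \<in> carrier A" by simp
  show "\<forall>\<^sub>F n in sequentially. yn n \<oplus>\<^bsub>An n\<^esub> zn n \<in> carrier (An n)"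
    using approximable_closed(2)[OF y] approximable_closed(2)[OF z] by eventually_elim simp
  fix e :: real assume "e > 0"
  then have e2: "e / 2 > 0" by simp
  obtain p where p: "p \<in> nc_polys (2 * m)" "nrm A (poly_eval A a p \<ominus>\<^bsub>A\<^esub> y) < e / 2"
    "\<forall>\<^sub>F n in sequentially. nrm (An n) (poly_eval (An n) (an n) p \<ominus>\<^bsub>An n\<^esub> yn n) < e / 2"
    using y e2 by (rule approximableE)
  obtain q where q: "q \<in> nc_polys (2 * m)" "nrm A (poly_eval A a q \<ominus>\<^bsub>A\<^esub> z) < e / 2"
    "\<forall>\<^sub>F n in sequentially. nrm (An n) (poly_eval (An n) (an n) q \<ominus>\<^bsub>An n\<^esub> zn n) < e / 2"
    using z e2 by (rule approximableE)
  have "nrm A (poly_eval A a (p + q) \<ominus>\<^bsub>A\<^esub> (y \<oplus>\<^bsub>A\<^esub> z)) < e"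
    using A.nrm_add_diff[OF A.poly_eval_closed[OF p(1)] A.poly_eval_closed[OF q(1)], of y z]
      p q by (simp add: A.poly_eval_add)
  moreover have "\<forall>\<^sub>F n in sequentially.
      nrm (An n) (poly_eval (An n) (an n) (p + q) \<ominus>\<^bsub>An n\<^esub> (yn n \<oplus>\<^bsub>An n\<^esub> zn n)) < e"
    using p(3) q(3) approximable_closed(2)[OF y] approximable_closed(2)[OF z]
  proof eventually_elim
    case (elim n)
    then show ?case
      using An.nrm_add_diff[OF An.poly_eval_closed[OF p(1)] An.poly_eval_closed[OF q(1)],
          of "yn n" n "zn n"] p(1) q(1)
      by (simp add: An.poly_eval_add)
  qed
  ultimately show "\<exists>fn f. approximable fn f \<and> nrm A (f \<ominus>\<^bsub>A\<^esub> (y \<oplus>\<^bsub>A\<^esub> z)) < e \<and>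
      (\<forall>\<^sub>F n in sequentially. nrm (An n) (fn n \<ominus>\<^bsub>An n\<^esub> (yn n \<oplus>\<^bsub>An n\<^esub> zn n)) < e)"
    using approximable_poly[OF nc_polys_add[OF p(1) q(1)]] by blast
qed

lemma approximable_mult:
  assumes y: "approximable yn y" and z: "approximable zn z"
  shows "approximable (\<lambda>n. yn n \<otimes>\<^bsub>An n\<^esub> zn n) (y \<otimes>\<^bsub>A\<^esub> z)"
proof (rule approximable_limit)
  note [simp] = approximable_closed(1)[OF y] approximable_closed(1)[OF z]
  show "y \<otimes>\<^bsub>A\<^esub> z \<in> carrier A" by simp
  show "\<forall>\<^sub>F n in sequentially. yn n \<otimes>\<^bsub>An n\<^esub> zn n \<in> carrier (An n)"
    using approximable_closed(2)[OF y] approximable_closed(2)[OF z] by eventually_elim simp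
  fix e :: real assume e: "e > 0"
  \<comment> \<open>Strictly above both limit norms, so that convergence of norms puts almost all
    \<open>yn n\<close> and \<open>zn n\<close> below \<open>M\<close> as well.\<close>
  define M where "M = max (nrm A y) (nrm A z) + 1"
  have M: "nrm A y < M" "nrm A z < M" "M > 0"
    using A.nrm_nonneg[of y] by (auto simp: M_def)
  have bounds: "\<forall>\<^sub>F n in sequentially. nrm (An n) (yn n) < M"
    "\<forall>\<^sub>F n in sequentially. nrm (An n) (zn n) < M"
    using approximable_nrm[OF y] approximable_nrm[OF z] M by (auto dest: order_tendstoD)
  \<comment> \<open>The bound of \<open>nrm_mult_diff_le\<close> becomes at most
    \<open>e / 2\<close>; the minimum with 1 meets its side condition.\<close>
  define \<delta> where "\<delta> = min 1 (e / (2 * (2 * M + 1)))"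
  have \<delta>: "\<delta> > 0" "\<delta> \<le> 1"
    using e M by (auto simp: \<delta>_def)
  have "\<delta> * (2 * M + 1) \<le> e / (2 * (2 * M + 1)) * (2 * M + 1)"
    using M by (intro mult_right_mono) (auto simp: \<delta>_def)
  also have "\<dots> < e"
    using M e by (simp add: field_simps add_pos_pos)
  finally have small: "\<delta> * (2 * M + 1) < e" .
  obtain p where p: "p \<in> nc_polys (2 * m)" "nrm A (poly_eval A a p \<ominus>\<^bsub>A\<^esub> y) < \<delta>"
    "\<forall>\<^sub>F n in sequentially. nrm (An n) (poly_eval (An n) (an n) p \<ominus>\<^bsub>An n\<^esub> yn n) < \<delta>"
    using y \<delta>(1) by (rule approximableE)
  obtain q where q: "q \<in> nc_polys (2 * m)" "nrm A (poly_eval A a q \<ominus>\<^bsub>A\<^esub> z) < \<delta>"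
    "\<forall>\<^sub>F n in sequentially. nrm (An n) (poly_eval (An n) (an n) q \<ominus>\<^bsub>An n\<^esub> zn n) < \<delta>"
    using z \<delta>(1) by (rule approximableE)
  have "nrm A (poly_eval A a (nc_mult p q) \<ominus>\<^bsub>A\<^esub> (y \<otimes>\<^bsub>A\<^esub> z)) < e"
    using A.nrm_mult_diff_le[OF A.poly_eval_closed[OF p(1)] A.poly_eval_closed[OF q(1)],
        of y z M \<delta>] p q M \<delta> small by (simp add: A.poly_eval_mult)
  moreover have "\<forall>\<^sub>F n in sequentially.
      nrm (An n) (poly_eval (An n) (an n) (nc_mult p q) \<ominus>\<^bsub>An n\<^esub> (yn n \<otimes>\<^bsub>An n\<^esub> zn n)) < e"
    using p(3) q(3) bounds approximable_closed(2)[OF y] approximable_closed(2)[OF z]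
  proof eventually_elim
    case (elim n)
    then show ?case
      using An.nrm_mult_diff_le[OF An.poly_eval_closed[OF p(1)] An.poly_eval_closed[OF q(1)],
          of "yn n" n "zn n" M \<delta>] p(1) q(1) \<delta> small
      by (simp add: An.poly_eval_mult)
  qed
  ultimately show "\<exists>fn f. approximable fn f \<and> nrm A (f \<ominus>\<^bsub>A\<^esub> (y \<otimes>\<^bsub>A\<^esub> z)) < e \<and>
      (\<forall>\<^sub>F n in sequentially. nrm (An n) (fn n \<ominus>\<^bsub>An n\<^esub> (yn n \<otimes>\<^bsub>An n\<^esub> zn n)) < e)"
    using approximable_poly[OF nc_polys_mult[OF p(1) q(1)]] by blast
qed

lemma approximable_adj:
  assumes y: "approximable yn y"
  shows "approximable (\<lambda>n. adj (An n) (yn n)) (adj A y)"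
proof (rule approximable_limit)
  note [simp] = approximable_closed(1)[OF y]
  show "adj A y \<in> carrier A" by simp
  show "\<forall>\<^sub>F n in sequentially. adj (An n) (yn n) \<in> carrier (An n)"
    using approximable_closed(2)[OF y] by eventually_elim simp
  fix e :: real assume e: "e > 0"
  obtain p where p: "p \<in> nc_polys (2 * m)" "nrm A (poly_eval A a p \<ominus>\<^bsub>A\<^esub> y) < e"
    "\<forall>\<^sub>F n in sequentially. nrm (An n) (poly_eval (An n) (an n) p \<ominus>\<^bsub>An n\<^esub> yn n) < e"
    using y e by (rule approximableE)
  have star: "poly_eval A a (nc_star m p) = adj A (poly_eval A a p)"
    by (intro A.poly_eval_star p(1) refl adj_adjoin_adj A_cstar x_closed)
  have star_n: "poly_eval (An n) (an n) (nc_star m p) = adj (An n) (poly_eval (An n) (an n) p)" for n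
    by (intro An.poly_eval_star p(1) refl adj_adjoin_adj An_cstar xn_closed)
  have "nrm A (poly_eval A a (nc_star m p) \<ominus>\<^bsub>A\<^esub> adj A y) < e"
    using p(2) A.poly_eval_closed[OF p(1)] by (simp add: star A.nrm_adj flip: A.adj_minus)
  moreover have "\<forall>\<^sub>F n in sequentially.
      nrm (An n) (poly_eval (An n) (an n) (nc_star m p) \<ominus>\<^bsub>An n\<^esub> adj (An n) (yn n)) < e"
    using p(3) approximable_closed(2)[OF y]
    by eventually_elim
      (simp add: star_n An.poly_eval_closed[OF p(1)] An.nrm_adj flip: An.adj_minus)
  ultimately show "\<exists>fn f. approximable fn f \<and> nrm A (f \<ominus>\<^bsub>A\<^esub> adj A y) < e \<and>
      (\<forall>\<^sub>F n in sequentially. nrm (An n) (fn n \<ominus>\<^bsub>An n\<^esub> adj (An n) (yn n)) < e)"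
    using approximable_poly[OF nc_polys_star[OF p(1)]] by blast
qed

lemma approximable_smult:
  assumes y: "approximable yn y"
  shows "approximable (\<lambda>n. c \<odot>\<^bsub>An n\<^esub> yn n) (c \<odot>\<^bsub>A\<^esub> y)"
proof -
  have "approximable (\<lambda>n. (c \<odot>\<^bsub>An n\<^esub> \<one>\<^bsub>An n\<^esub>) \<otimes>\<^bsub>An n\<^esub> yn n) ((c \<odot>\<^bsub>A\<^esub> \<one>\<^bsub>A\<^esub>) \<otimes>\<^bsub>A\<^esub> y)"
    by (intro approximable_mult approximable_const y)
  moreover have "(c \<odot>\<^bsub>A\<^esub> \<one>\<^bsub>A\<^esub>) \<otimes>\<^bsub>A\<^esub> y = c \<odot>\<^bsub>A\<^esub> y"
    using approximable_closed(1)[OF y] by (simp add: A.smult_mult_left)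
  moreover have "\<forall>\<^sub>F n in sequentially. (c \<odot>\<^bsub>An n\<^esub> \<one>\<^bsub>An n\<^esub>) \<otimes>\<^bsub>An n\<^esub> yn n = c \<odot>\<^bsub>An n\<^esub> yn n"
    using approximable_closed(2)[OF y] by eventually_elim (simp add: An.smult_mult_left)
  ultimately show ?thesis
    using approximable_cong by simp
qed

lemma approximable_minus:
  assumes y: "approximable yn y" and z: "approximable zn z"
  shows "approximable (\<lambda>n. yn n \<ominus>\<^bsub>An n\<^esub> zn n) (y \<ominus>\<^bsub>A\<^esub> z)"
proof -
  have "approximable (\<lambda>n. yn n \<oplus>\<^bsub>An n\<^esub> (- 1) \<odot>\<^bsub>An n\<^esub> zn n) (y \<oplus>\<^bsub>A\<^esub> (- 1) \<odot>\<^bsub>A\<^esub> z)"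
    by (intro approximable_add approximable_smult assms)
  moreover have "y \<oplus>\<^bsub>A\<^esub> (- 1) \<odot>\<^bsub>A\<^esub> z = y \<ominus>\<^bsub>A\<^esub> z"
    using approximable_closed(1)[OF z]
    by (simp add: A.smult_uminus_left A.smult_one A.minus_eq)
  moreover have "\<forall>\<^sub>F n in sequentially. yn n \<oplus>\<^bsub>An n\<^esub> (- 1) \<odot>\<^bsub>An n\<^esub> zn n = yn n \<ominus>\<^bsub>An n\<^esub> zn n"
    using approximable_closed(2)[OF z]
    by eventually_elim (simp add: An.smult_uminus_left An.smult_one An.minus_eq)
  ultimately show ?thesis
    using approximable_cong by simp
qed

section \<open>Stability under inversion\<close>

lemma approximable_neumann_sum:
  assumes "approximable zn z"
  shows "approximable (\<lambda>n. An.neumann_sum n (zn n) K) (A.neumann_sum z K)"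
  by (induction K)
    (simp_all add: approximable_zero approximable_add approximable_one approximable_mult assms)

text \<open>Convergence of norms turns \<open>nrm A z < 1\<close> into
  \<open>nrm (An n) (zn n) < \<rho>\<close> for almost all \<open>n\<close>. The truncation error
  \<open>\<rho> ^ K / (1 - \<rho>)\<close> is then common to all of them and to the limit, so the
  partial sums are uniform approximants.\<close>

lemma approximable_neumann_series:
  assumes z: "approximable zn z" and less: "nrm A z < 1"
  obtains gn g where "approximable gn g" "g \<otimes>\<^bsub>A\<^esub> (\<one>\<^bsub>A\<^esub> \<ominus>\<^bsub>A\<^esub> z) = \<one>\<^bsub>A\<^esub>"
    "\<forall>\<^sub>F n in sequentially. gn n \<otimes>\<^bsub>An n\<^esub> (\<one>\<^bsub>An n\<^esub> \<ominus>\<^bsub>An n\<^esub> zn n) = \<one>\<^bsub>An n\<^esub>"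
proof -
  obtain \<rho> where \<rho>: "nrm A z < \<rho>" "\<rho> < 1"
    using dense[OF less] by blast
  have \<rho>0: "0 \<le> \<rho>"
    using A.nrm_nonneg[OF approximable_closed(1)[OF z]] \<rho>(1) by simp
  obtain g where g: "g \<in> carrier A" "g \<otimes>\<^bsub>A\<^esub> (\<one>\<^bsub>A\<^esub> \<ominus>\<^bsub>A\<^esub> z) = \<one>\<^bsub>A\<^esub>"
    "\<And>K. nrm A (A.neumann_sum z K \<ominus>\<^bsub>A\<^esub> g) \<le> \<rho> ^ K / (1 - \<rho>)"
    using A.neumann_series[OF approximable_closed(1)[OF z] less_imp_le[OF \<rho>(1)] \<rho>(2)] by blast
  define P where "P n b \<longleftrightarrow> b \<in> carrier (An n) \<and>
      b \<otimes>\<^bsub>An n\<^esub> (\<one>\<^bsub>An n\<^esub> \<ominus>\<^bsub>An n\<^esub> zn n) = \<one>\<^bsub>An n\<^esub> \<and>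
      (\<forall>K. nrm (An n) (An.neumann_sum n (zn n) K \<ominus>\<^bsub>An n\<^esub> b) \<le> \<rho> ^ K / (1 - \<rho>))" for n b
  \<comment> \<open>For some initial \<open>n\<close> there may be no suitable element; the choice
    is arbitrary there, and \<open>P n (gn n)\<close> holds only eventually.\<close>
  define gn where "gn n = (SOME b. P n b)" for n
  have "\<forall>\<^sub>F n in sequentially. nrm (An n) (zn n) < \<rho>"
    using approximable_nrm[OF z] \<rho>(1) by (rule order_tendstoD)
  then have P: "\<forall>\<^sub>F n in sequentially. P n (gn n)"
    using approximable_closed(2)[OF z]
  proof eventually_elim
    case (elim n)
    obtain b where "P n b"
      unfolding P_def using An.neumann_series[OF elim(2) less_imp_le[OF elim(1)] \<rho>(2)] by blast
    then show ?case
      unfolding gn_def by (rule someI)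
  qed
  have lim0: "(\<lambda>K. \<rho> ^ K / (1 - \<rho>)) \<longlonglongrightarrow> 0"
    using \<rho>0 \<rho>(2) tendsto_divide_zero[OF LIMSEQ_power_zero[of \<rho>]] by simp
  have "approximable gn g"
  proof (rule approximable_limit)
    show "\<forall>\<^sub>F n in sequentially. gn n \<in> carrier (An n)"
      using P by eventually_elim (simp add: P_def)
    fix e :: real assume "e > 0"
    then have "\<forall>\<^sub>F K in sequentially. \<rho> ^ K / (1 - \<rho>) < e"
      using lim0 by (auto dest: order_tendstoD)
    then obtain K where K: "\<rho> ^ K / (1 - \<rho>) < e"
      by (auto simp: eventually_sequentially)
    have "nrm A (A.neumann_sum z K \<ominus>\<^bsub>A\<^esub> g) < e"
      using g(3)[of K] K by simp
    moreover have "\<forall>\<^sub>F n in sequentially.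
        nrm (An n) (An.neumann_sum n (zn n) K \<ominus>\<^bsub>An n\<^esub> gn n) < e"
      using P K by (auto simp: P_def elim!: eventually_mono intro: le_less_trans)
    ultimately show "\<exists>fn f. approximable fn f \<and> nrm A (f \<ominus>\<^bsub>A\<^esub> g) < e \<and>
        (\<forall>\<^sub>F n in sequentially. nrm (An n) (fn n \<ominus>\<^bsub>An n\<^esub> gn n) < e)"
      using approximable_neumann_sum[OF z] by blast
  qed (rule g)
  moreover have "\<forall>\<^sub>F n in sequentially. gn n \<otimes>\<^bsub>An n\<^esub> (\<one>\<^bsub>An n\<^esub> \<ominus>\<^bsub>An n\<^esub> zn n) = \<one>\<^bsub>An n\<^esub>"
    using P by eventually_elim (simp add: P_def)
  ultimately show thesis
    using that g(2) by blast
qed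

text \<open>The scalar \<open>t\<close> is chosen in the limit algebra alone and reused for every
  \<open>n\<close>. The left inverse is given by the same expression in all algebras, so its
  approximability follows from the stability lemmas.\<close>

lemma approximable_left_inverse:
  assumes y: "approximable yn y" and unit: "y \<in> Units A"
  obtains gn g where "approximable gn g" "g \<otimes>\<^bsub>A\<^esub> y = \<one>\<^bsub>A\<^esub>"
    "\<forall>\<^sub>F n in sequentially. gn n \<otimes>\<^bsub>An n\<^esub> yn n = \<one>\<^bsub>An n\<^esub>"
proof -
  note yc [simp] = approximable_closed(1)[OF y]
  define h hn where "h = adj A y \<otimes>\<^bsub>A\<^esub> y" and "hn n = adj (An n) (yn n) \<otimes>\<^bsub>An n\<^esub> yn n" for n
  have "h \<in> Units A"
    unfolding h_def by (intro A.Units_m_closed A.adj_Units unit)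
  moreover have "adj A h = h"
    by (simp add: h_def A.adj_mult A.adj_adj)
  ultimately obtain t :: real where t: "nrm A (\<one>\<^bsub>A\<^esub> \<ominus>\<^bsub>A\<^esub> complex_of_real t \<odot>\<^bsub>A\<^esub> (h \<otimes>\<^bsub>A\<^esub> h)) < 1"
    by (rule A.ex_nrm_one_minus_square_less)
  have h: "approximable hn h"
    unfolding h_def hn_def by (intro approximable_mult approximable_adj y)
  have "approximable (\<lambda>n. \<one>\<^bsub>An n\<^esub> \<ominus>\<^bsub>An n\<^esub> complex_of_real t \<odot>\<^bsub>An n\<^esub> (hn n \<otimes>\<^bsub>An n\<^esub> hn n))
      (\<one>\<^bsub>A\<^esub> \<ominus>\<^bsub>A\<^esub> complex_of_real t \<odot>\<^bsub>A\<^esub> (h \<otimes>\<^bsub>A\<^esub> h))"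
    by (intro approximable_minus approximable_one approximable_smult approximable_mult h)
  then obtain kn k where k: "approximable kn k"
    and k_inv: "k \<otimes>\<^bsub>A\<^esub> (\<one>\<^bsub>A\<^esub> \<ominus>\<^bsub>A\<^esub> (\<one>\<^bsub>A\<^esub> \<ominus>\<^bsub>A\<^esub> complex_of_real t \<odot>\<^bsub>A\<^esub> (h \<otimes>\<^bsub>A\<^esub> h))) = \<one>\<^bsub>A\<^esub>"
    and kn_inv: "\<forall>\<^sub>F n in sequentially. kn n \<otimes>\<^bsub>An n\<^esub> (\<one>\<^bsub>An n\<^esub> \<ominus>\<^bsub>An n\<^esub>
        (\<one>\<^bsub>An n\<^esub> \<ominus>\<^bsub>An n\<^esub> complex_of_real t \<odot>\<^bsub>An n\<^esub> (hn n \<otimes>\<^bsub>An n\<^esub> hn n))) = \<one>\<^bsub>An n\<^esub>"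
    using t by (rule approximable_neumann_series)
  show thesis
  proof
    show "approximable
        (\<lambda>n. kn n \<otimes>\<^bsub>An n\<^esub> (complex_of_real t \<odot>\<^bsub>An n\<^esub> (hn n \<otimes>\<^bsub>An n\<^esub> adj (An n) (yn n))))
        (k \<otimes>\<^bsub>A\<^esub> (complex_of_real t \<odot>\<^bsub>A\<^esub> (h \<otimes>\<^bsub>A\<^esub> adj A y)))"
      by (intro approximable_mult approximable_smult approximable_adj k h y)
    show "(k \<otimes>\<^bsub>A\<^esub> (complex_of_real t \<odot>\<^bsub>A\<^esub> (h \<otimes>\<^bsub>A\<^esub> adj A y))) \<otimes>\<^bsub>A\<^esub> y = \<one>\<^bsub>A\<^esub>"
      using k_inv unfolding h_def
      by (intro A.left_inverse_of_square yc approximable_closed(1)[OF k])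
    show "\<forall>\<^sub>F n in sequentially. kn n \<otimes>\<^bsub>An n\<^esub> (complex_of_real t \<odot>\<^bsub>An n\<^esub>
        (hn n \<otimes>\<^bsub>An n\<^esub> adj (An n) (yn n))) \<otimes>\<^bsub>An n\<^esub> yn n = \<one>\<^bsub>An n\<^esub>"
      using kn_inv approximable_closed(2)[OF k] approximable_closed(2)[OF y] unfolding hn_def
      by eventually_elim (rule An.left_inverse_of_square)
  qed
qed

text \<open>The adjoint of a left inverse of \<open>y\<^sup>*\<close> is a right inverse of
  \<open>y\<close>. Having both sides shows that \<open>yn n\<close> is a unit for almost all
  \<open>n\<close> and identifies its inverse with \<open>gn n\<close>, whose approximability is
  known.\<close>

lemma approximable_inverse:
  assumes y: "approximable yn y" and unit: "y \<in> Units A"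
  shows "\<forall>\<^sub>F n in sequentially. yn n \<in> Units (An n)"
    and "approximable (\<lambda>n. inv\<^bsub>An n\<^esub> yn n) (inv\<^bsub>A\<^esub> y)"
proof -
  note yc [simp] = approximable_closed(1)[OF y]
  obtain gn g where g: "approximable gn g" "g \<otimes>\<^bsub>A\<^esub> y = \<one>\<^bsub>A\<^esub>"
    "\<forall>\<^sub>F n in sequentially. gn n \<otimes>\<^bsub>An n\<^esub> yn n = \<one>\<^bsub>An n\<^esub>"
    using y unit by (rule approximable_left_inverse)
  obtain kn k where k: "approximable kn k" "k \<otimes>\<^bsub>A\<^esub> adj A y = \<one>\<^bsub>A\<^esub>"
    "\<forall>\<^sub>F n in sequentially. kn n \<otimes>\<^bsub>An n\<^esub> adj (An n) (yn n) = \<one>\<^bsub>An n\<^esub>"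
    using approximable_adj[OF y] A.adj_Units[OF unit] by (rule approximable_left_inverse)
  have ev: "\<forall>\<^sub>F n in sequentially. yn n \<in> Units (An n) \<and> inv\<^bsub>An n\<^esub> yn n = gn n"
    using g(3) k(3) approximable_closed(2)[OF y] approximable_closed(2)[OF g(1)]
      approximable_closed(2)[OF k(1)]
  proof eventually_elim
    case (elim n)
    have "yn n \<otimes>\<^bsub>An n\<^esub> adj (An n) (kn n) = \<one>\<^bsub>An n\<^esub>"
      using An.adj_mult[of "kn n" n "adj (An n) (yn n)"] elim by (simp add: An.adj_adj)
    then show ?case
      using An.Units_if_left_right_inverse[of "yn n" n "gn n" "adj (An n) (kn n)"] elim by simp
  qed
  then show "\<forall>\<^sub>F n in sequentially. yn n \<in> Units (An n)"
    by eventually_elim simp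
  have "inv\<^bsub>A\<^esub> y = g"
    using approximable_closed(1)[OF g(1)] g(2) unit by (intro A.inv_eq_left) auto
  moreover have "\<forall>\<^sub>F n in sequentially. gn n = inv\<^bsub>An n\<^esub> yn n"
    using ev by eventually_elim simp
  ultimately show "approximable (\<lambda>n. inv\<^bsub>An n\<^esub> yn n) (inv\<^bsub>A\<^esub> y)"
    using approximable_cong[OF g(1)] by simp
qed

section \<open>Rational expressions\<close>

lemma approximable_word_prod:
  assumes "\<And>l. l \<in> set w \<Longrightarrow> approximable (\<lambda>n. fn n l) (f l)"
  shows "approximable (\<lambda>n. word_prod (An n) (map (fn n) w)) (word_prod A (map f w))"
  using assms
  by (induction w)
    (simp_all add: A.word_prod_Nil An.word_prod_Nil A.word_prod_Cons An.word_prod_Cons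
      approximable_one approximable_mult)

text \<open>\<open>finsum_insert\<close> needs all summands in the carrier. Along the sequence this
  holds only eventually, simultaneously for all summands because \<open>S\<close> is finite; hence
  the detour through \<open>approximable_cong\<close>.\<close>

lemma approximable_finsum:
  assumes "finite S" and "\<And>s. s \<in> S \<Longrightarrow> approximable (\<lambda>n. fn n s) (f s)"
  shows "approximable (\<lambda>n. finsum (An n) (fn n) S) (finsum A f S)"
  using assms
proof (induction S)
  case empty
  then show ?case by (simp add: approximable_zero)
next
  case (insert s S)
  have sum: "approximable (\<lambda>n. fn n s \<oplus>\<^bsub>An n\<^esub> finsum (An n) (fn n) S) (f s \<oplus>\<^bsub>A\<^esub> finsum A f S)"
    using insert by (intro approximable_add) auto
  have "finsum A f (insert s S) = f s \<oplus>\<^bsub>A\<^esub> finsum A f S"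
    using insert.hyps insert.prems[THEN approximable_closed(1)] by (intro A.finsum_insert) auto
  moreover have "\<forall>\<^sub>F n in sequentially. \<forall>u\<in>insert s S. fn n u \<in> carrier (An n)"
    using insert.hyps(1) insert.prems[THEN approximable_closed(2)]
    by (intro eventually_ball_finite) auto
  then have "\<forall>\<^sub>F n in sequentially.
      fn n s \<oplus>\<^bsub>An n\<^esub> finsum (An n) (fn n) S = finsum (An n) (fn n) (insert s S)"
  proof eventually_elim
    case (elim n)
    then show ?case
      using insert.hyps by (intro An.finsum_insert[symmetric]) auto
  qed
  ultimately show ?case
    using approximable_cong[OF sum] by simp
qed

text \<open>Definedness and approximability go through the induction together: for an inverse
  letter, it is the approximability of the inner value that makes it invertible for almost all
  \<open>n\<close>.\<close>

lemma approximable_rat_eval: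
  assumes "r \<in> rat_exprs (2 * m) k" and "rat_eval A a r = Some y"
  shows "(\<forall>\<^sub>F n in sequentially. rat_eval (An n) (an n) r \<noteq> None) \<and>
    approximable (\<lambda>n. the (rat_eval (An n) (an n) r)) y"
  using assms
proof (induction k arbitrary: r y)
  case 0
  then obtain p where "r = Poly p" "p \<in> nc_polys (2 * m)"
    by auto
  then show ?case
    using 0 approximable_poly[of p] by auto
next
  case (Suc k)
  then obtain S where S: "r = Comb S"
    and letters: "fst ` fset S \<subseteq>
      lists (Letter ` rat_exprs (2 * m) k \<union> InvLetter ` rat_exprs (2 * m) k)"
    by auto
  have dom: "\<forall>wc\<in>fset S. \<forall>l\<in>set (fst wc). letter_eval A a l \<noteq> None"
    and y: "y = finsum A (\<lambda>wc. snd wc \<odot>\<^bsub>A\<^esub>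
      word_prod A (map (\<lambda>l. the (letter_eval A a l)) (fst wc))) (fset S)"
    using Suc.prems(2) by (auto simp: S split: if_splits)
  have letter: "(\<forall>\<^sub>F n in sequentially. letter_eval (An n) (an n) l \<noteq> None) \<and>
      approximable (\<lambda>n. the (letter_eval (An n) (an n) l)) (the (letter_eval A a l))"
    if wc: "wc \<in> fset S" "l \<in> set (fst wc)" for wc l
  proof -
    obtain v where v: "letter_eval A a l = Some v"
      using dom wc by blast
    have "l \<in> Letter ` rat_exprs (2 * m) k \<union> InvLetter ` rat_exprs (2 * m) k"
      using wc letters by blast
    then consider q where "l = Letter q" "q \<in> rat_exprs (2 * m) k"
      | q where "l = InvLetter q" "q \<in> rat_exprs (2 * m) k"
      by blast
    then show ?thesis
    proof cases
      case 1
      then show ?thesis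
        using Suc.IH[of q v] v by simp
    next
      case 2
      then obtain b where b: "rat_eval A a q = Some b" "b \<in> Units A" "v = inv\<^bsub>A\<^esub> b"
        using v by (auto split: option.splits if_splits)
      define bn where "bn = (\<lambda>n. the (rat_eval (An n) (an n) q))"
      have def: "\<forall>\<^sub>F n in sequentially. rat_eval (An n) (an n) q \<noteq> None" and bn: "approximable bn b"
        using Suc.IH[OF 2(2) b(1)] by (auto simp: bn_def)
      have ev: "\<forall>\<^sub>F n in sequentially. letter_eval (An n) (an n) l = Some (inv\<^bsub>An n\<^esub> bn n)"
        using def approximable_inverse(1)[OF bn b(2)]
        by eventually_elim (auto simp: 2(1) bn_def)
      have "approximable (\<lambda>n. the (letter_eval (An n) (an n) l)) (inv\<^bsub>A\<^esub> b)"
        using approximable_inverse(2)[OF bn b(2)]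
        by (rule approximable_cong) (use ev in eventually_elim, simp)
      moreover have "\<forall>\<^sub>F n in sequentially. letter_eval (An n) (an n) l \<noteq> None"
        using ev by eventually_elim simp
      ultimately show ?thesis
        using v b(3) by simp
    qed
  qed
  \<comment> \<open>Finitely many words with finitely many letters each, so one threshold for
    \<open>n\<close> serves all letters.\<close>
  have "\<forall>\<^sub>F n in sequentially. \<forall>wc\<in>fset S. \<forall>l\<in>set (fst wc). letter_eval (An n) (an n) l \<noteq> None"
    using letter by (intro eventually_ball_finite ballI) auto
  then have ev: "\<forall>\<^sub>F n in sequentially. rat_eval (An n) (an n) r =
      Some (finsum (An n) (\<lambda>wc. snd wc \<odot>\<^bsub>An n\<^esub>
        word_prod (An n) (map (\<lambda>l. the (letter_eval (An n) (an n) l)) (fst wc))) (fset S))"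
    by eventually_elim (simp add: S)
  have "approximable (\<lambda>n. finsum (An n) (\<lambda>wc. snd wc \<odot>\<^bsub>An n\<^esub>
        word_prod (An n) (map (\<lambda>l. the (letter_eval (An n) (an n) l)) (fst wc))) (fset S)) y"
    unfolding y using letter
    by (intro approximable_finsum approximable_smult approximable_word_prod) auto
  then have "approximable (\<lambda>n. the (rat_eval (An n) (an n) r)) y"
    by (rule approximable_cong) (use ev in eventually_elim, simp)
  moreover have "\<forall>\<^sub>F n in sequentially. rat_eval (An n) (an n) r \<noteq> None"
    using ev by eventually_elim simp
  ultimately show ?case by simp
qed

end

theorem mainTheorem1:
  fixes An :: "nat \<Rightarrow> 'a cstar_struct" and \<tau>n :: "nat \<Rightarrow> 'a \<Rightarrow> complex"
    and A :: "'b cstar_struct" and \<tau> :: "'b \<Rightarrow> complex"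
    and m :: nat and xn :: "nat \<Rightarrow> nat \<Rightarrow> 'a" and x :: "nat \<Rightarrow> 'b"
    and k :: nat and r :: rat_expr
  assumes "\<And>n. cstar_probability_space_faithful_trace (An n) (\<tau>n n)"
    and "cstar_probability_space_faithful_trace A \<tau>"
    and "\<And>n i. i < m \<Longrightarrow> xn n i \<in> carrier (An n)"
    and "\<And>i. i < m \<Longrightarrow> x i \<in> carrier A"
    and "strongly_converges m An \<tau>n xn A \<tau> x"
    and "r \<in> rat_exprs (2 * m) k"
    and "in_domain A (adjoin_adj A m x) r"
  shows "(\<forall>\<^sub>F n in sequentially. in_domain (An n) (adjoin_adj (An n) m (xn n)) r) \<and>
    (\<lambda>n. \<tau>n n (rat_value (An n) (adjoin_adj (An n) m (xn n)) r))
      \<longlonglongrightarrow> \<tau> (rat_value A (adjoin_adj A m x) r) \<and>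
    (\<lambda>n. nrm (An n) (rat_value (An n) (adjoin_adj (An n) m (xn n)) r))
      \<longlonglongrightarrow> nrm A (rat_value A (adjoin_adj A m x) r)"
proof -
  have Pn: "cstar_probability_space (An n) (\<tau>n n)" for n
    using assms(1) by (rule cstar_probability_space_faithful_trace.axioms)
  have P: "cstar_probability_space A \<tau>"
    using assms(2) by (rule cstar_probability_space_faithful_trace.axioms)
  interpret nc_approximation An A m xn x
    using assms(3-5)
    by (intro nc_approximation.intro cstar_probability_space.axioms(1)[OF Pn]
        cstar_probability_space.axioms(1)[OF P]) (auto simp: strongly_converges_def)
  obtain y where y: "rat_eval A a r = Some y"
    using assms(7) by (auto simp: in_domain_def)
  have dom: "\<forall>\<^sub>F n in sequentially. in_domain (An n) (an n) r"
    and appr: "approximable (\<lambda>n. rat_value (An n) (an n) r) (rat_value A a r)"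
    using approximable_rat_eval[OF assms(6) y] y by (simp_all add: in_domain_def rat_value_def)
  have "(\<lambda>n. \<tau>n n (rat_value (An n) (an n) r)) \<longlonglongrightarrow> \<tau> (rat_value A a r)"
  \<comment> \<open>Strong convergence supplies the limits on polynomials, and
    \<open>state_bound\<close>, applied to differences, the common Lipschitz constant 2.\<close>
  proof (rule approximable_tendsto[OF appr, where C = 2])
    show "dist (\<tau>n n b) (\<tau>n n c) \<le> 2 * nrm (An n) (b \<ominus>\<^bsub>An n\<^esub> c)"
      if "b \<in> carrier (An n)" "c \<in> carrier (An n)" for n b c
      using cstar_probability_space.state_bound[OF Pn, of "b \<ominus>\<^bsub>An n\<^esub> c" n]
        cstar_probability_space.state_minus[OF Pn that] that
      by (simp add: dist_norm)
    show "dist (\<tau> b) (\<tau> c) \<le> 2 * nrm A (b \<ominus>\<^bsub>A\<^esub> c)" if "b \<in> carrier A" "c \<in> carrier A" for b c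
      using cstar_probability_space.state_bound[OF P, of "b \<ominus>\<^bsub>A\<^esub> c"]
        cstar_probability_space.state_minus[OF P that] that
      by (simp add: dist_norm)
  qed (use assms(5) in \<open>auto simp: strongly_converges_def\<close>)
  with dom approximable_nrm[OF appr] show ?thesis
    by blast
qed

end
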